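(* Let $0\le\mu\le1/3$ and $\mathcal{R}_1=\{\mathbf{Y}\in\mathbb{R}^{p\times r}_*:d([\mathbf{Y}],[\mathbf{Y}^*])\le\mu\sigma_r(\mathbf{Y}^* )/\kappa^*\}$. Then for every $\mathbf{Y}\in\mathcal{R}_1$, $$\lambda_{\min}(\overline{\mathrm{Hess}\,H([\mathbf{Y}])})\ge\big(2(1-\mu/\kappa^* )^2-(14/3)\mu\big)\sigma_r^2(\mathbf{Y}^* ),$$ $$\lambda_{\max}(\overline{\mathrm{Hess}\,H([\mathbf{Y}])})\le4\big(\sigma_1(\mathbf{Y}^* )+\mu\sigma_r(\mathbf{Y}^* )/\kappa^*\big)^2+14\mu\sigma_r^2(\mathbf{Y}^* )/3 .$$ In particular, if in addition $(1-\mu/\kappa^* )^2-7\mu/3>0$ (for example $\mu<\frac{13-\sqrt{133}}{6}$), then $H$ is geodesically strongly convex and smooth in $\mathcal{R}_1$.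
   Context: Let $0<r\le p$ be integers. $\|\cdot\|_F$ is the Frobenius norm and $\sigma_i(\cdot)$ the $i$-th largest singular value. $\mathbb{R}^{p\times r}_*$ is the set of real $p\times r$ matrices of full column rank, $\mathbb{O}_r$ the orthogonal group, and $\mathcal{M}=\mathbb{R}^{p\times r}_*/\mathbb{O}_r$ the quotient manifold with points $[\mathbf{Y}]=\{\mathbf{Y}\mathbf{O}:\mathbf{O}\in\mathbb{O}_r\}$ and the Riemannian metric induced from $\mathrm{tr}(\eta^\top\theta)$; tangent vectors at $[\mathbf{Y}]$ are represented by horizontal lifts in $\mathcal{H}_{\mathbf{Y}}=\{\theta\in\mathbb{R}^{p\times r}:\mathbf{Y}^\top\theta\text{ symmetric}\}$, and $d([\mathbf{Y}_1],[\mathbf{Y}_2])=\min_{\mathbf{Q}\in\mathbb{O}_r}\|\mathbf{Y}_2\mathbf{Q}-\mathbf{Y}_1\|_F$ is the geodesic distance. $\mathbf{X}^*=\mathbf{Y}^*\mathbf{Y}^{*\top}$ is a symmetric positive semidefinite $p\times p$ matrix of rank $r$, with $\mathbf{Y}^*\in\mathbb{R}^{p\times r}_*$ and $\kappa^*=\sigma_1(\mathbf{Y}^* )/\sigma_r(\mathbf{Y}^* )$. $H([\mathbf{Y}])=\frac12\|\mathbf{Y}\mathbf{Y}^\top-\mathbf{X}^*\|_F^2$ on $\mathcal{M}$, whose lifted Riemannian Hessian is $\overline{\mathrm{Hess}\,H([\mathbf{Y}])}[\theta,\theta]=\|\mathbf{Y}\theta^\top+\theta\mathbf{Y}^\top\|_F^2+2\langle\mathbf{Y}\mathbf{Y}^\top-\mathbf{X}^*,\theta\theta^\top\rangle$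 for $\theta\in\mathcal{H}_{\mathbf{Y}}$; $\lambda_{\min},\lambda_{\max}$ are the minimum and maximum of this form over $\theta\in\mathcal{H}_{\mathbf{Y}}$ with $\|\theta\|_F=1$. A set in $\mathcal{M}$ is geodesically convex if any two of its points can be joined by a geodesic contained in it; a function is geodesically strongly convex on a set if the set is geodesically convex and the Riemannian Hessian is bounded below there by a positive multiple of the identity; it is smooth there if the Riemannian Hessian is bounded above there by a constant multiple of the identity. The $\mathbb{O}_r$-invariant set $\mathcal{R}_1$ is identified with its image in $\mathcal{M}$. *)

theory Defs
  imports "HOL-Analysis.Analysis" "HOL-Computational_Algebra.Polynomial"
begin

text \<open>
  A \<open>p \<times> r\<close> matrix has type \<^typ>\<open>real^'r^'p\<close>.  Library \<^const>\<open>inner\<close> and \<^const>\<open>norm\<close> on this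
  type are \<open>tr(\<eta>\<^sup>T \<theta>)\<close> and the Frobenius norm.
\<close>

subsection \<open>Singular values\<close>

definition charpoly :: "real^'n^'n \<Rightarrow> real poly" where
  "charpoly A = det (\<chi> i j. (if i = j then [:0, 1:] else 0) - [:A $ i $ j:])"

text \<open>Square roots of the eigenvalues of \<open>A\<^sup>T A\<close>, with multiplicity, in decreasing order.\<close>

definition singular_values :: "real^'n^'m \<Rightarrow> real list" where
  "singular_values A =
     rev (sorted_list_of_multiset (image_mset sqrt (proots (charpoly (transpose A ** A)))))"

text \<open>The index starts at 1, so that \<open>sing_val 1 A\<close> is the largest singular value.\<close>

definition sing_val :: "nat \<Rightarrow> real^'n^'m \<Rightarrow> real" where
  "sing_val i A = singular_values A ! (i - 1)"

definition cond_number :: "real^'r^'p \<Rightarrow> real" where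
  "cond_number Y = sing_val 1 Y / sing_val CARD('r) Y"

subsection \<open>The quotient manifold\<close>

definition full_column_rank :: "real^'r^'p \<Rightarrow> bool" where
  "full_column_rank Y \<longleftrightarrow> rank Y = CARD('r)"

definition orbit :: "real^'r^'p \<Rightarrow> (real^'r^'p) set" where
  "orbit Y = {Y ** Q | Q. orthogonal_matrix Q}"

definition quotient_manifold :: "(real^'r^'p) set set" where
  "quotient_manifold = orbit ` {Y. full_column_rank Y}"

text \<open>The distance between \<open>orbit Y1\<close> and \<open>orbit Y2\<close>; the infimum is a minimum, see
  \<open>quotient_dist_attained\<close> below.\<close>

definition quotient_dist :: "real^'r^'p \<Rightarrow> real^'r^'p \<Rightarrow> real" where
  "quotient_dist Y1 Y2 = Inf {norm (Y2 ** Q - Y1) | Q. orthogonal_matrix Q}"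

definition horizontal :: "real^'r^'p \<Rightarrow> (real^'r^'p) set" where
  "horizontal Y = {\<theta>. transpose (transpose Y ** \<theta>) = transpose Y ** \<theta>}"

text \<open>Orthogonal projection onto the horizontal subspace.\<close>

definition hor_proj :: "real^'r^'p \<Rightarrow> real^'r^'p \<Rightarrow> real^'r^'p" where
  "hor_proj Y = closest_point (horizontal Y)"

subsection \<open>Riemannian calculus through horizontal lifts\<close>

text \<open>
  Functions on the quotient are given on orbits.  The metric is the quotient of a flat one, so
  the horizontal lift of the Riemannian gradient is the Euclidean gradient of the lifted function
  (horizontal, because the lifted function is constant on orbits), and the Levi-Civita
  connection lifts to the Euclidean derivative followed by \<^const>\<open>hor_proj\<close>.
\<close>

definition lift :: "((real^'r^'p) set \<Rightarrow> real) \<Rightarrow> real^'r^'p \<Rightarrow> real" where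
  "lift f Y = f (orbit Y)"

definition lifted_grad :: "((real^'r^'p) set \<Rightarrow> real) \<Rightarrow> real^'r^'p \<Rightarrow> real^'r^'p" where
  "lifted_grad f Y = (THE D. GDERIV (lift f) Y :> D)"

definition twice_differentiable_at :: "((real^'r^'p) set \<Rightarrow> real) \<Rightarrow> real^'r^'p \<Rightarrow> bool" where
  "twice_differentiable_at f Y \<longleftrightarrow>
     (\<forall>\<^sub>F Z in nhds Y. \<exists>D. GDERIV (lift f) Z :> D) \<and> lifted_grad f differentiable (at Y)"

definition lifted_hess_op ::
    "((real^'r^'p) set \<Rightarrow> real) \<Rightarrow> real^'r^'p \<Rightarrow> real^'r^'p \<Rightarrow> real^'r^'p" where
  "lifted_hess_op f Y \<theta> = hor_proj Y (frechet_derivative (lifted_grad f) (at Y) \<theta>)"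

text \<open>The quadratic form \<open>Hess f([Y])[\<theta>, \<theta>]\<close>, meaningful for \<open>\<theta> \<in> horizontal Y\<close>.\<close>

definition lifted_hess ::
    "((real^'r^'p) set \<Rightarrow> real) \<Rightarrow> real^'r^'p \<Rightarrow> real^'r^'p \<Rightarrow> real" where
  "lifted_hess f Y \<theta> = inner (lifted_hess_op f Y \<theta>) \<theta>"

text \<open>For the cost function below the infimum and the supremum are attained, see
  \<open>hess_min_attained\<close> and \<open>hess_max_attained\<close>.\<close>

definition hess_min :: "((real^'r^'p) set \<Rightarrow> real) \<Rightarrow> real^'r^'p \<Rightarrow> real" where
  "hess_min f Y = Inf (lifted_hess f Y ` {\<theta> \<in> horizontal Y. norm \<theta> = 1})"

definition hess_max :: "((real^'r^'p) set \<Rightarrow> real) \<Rightarrow> real^'r^'p \<Rightarrow> real" where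
  "hess_max f Y = Sup (lifted_hess f Y ` {\<theta> \<in> horizontal Y. norm \<theta> = 1})"

text \<open>
  Geodesics are the curves with vanishing covariant acceleration.  Here \<open>c\<close> is a horizontal lift
  of the curve, with velocity \<open>v\<close> and Euclidean acceleration \<open>a\<close>.
\<close>

definition geodesic :: "(real \<Rightarrow> (real^'r^'p) set) \<Rightarrow> bool" where
  "geodesic \<gamma> \<longleftrightarrow>
     (\<exists>c v a. \<forall>t\<in>{0..1}.
        full_column_rank (c t) \<and> \<gamma> t = orbit (c t) \<and>
        (c has_vector_derivative v t) (at t within {0..1}) \<and> v t \<in> horizontal (c t) \<and>
        (v has_vector_derivative a t) (at t within {0..1}) \<and> hor_proj (c t) (a t) = 0)"

definition geodesically_convex :: "(real^'r^'p) set set \<Rightarrow> bool" where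
  "geodesically_convex S \<longleftrightarrow>
     S \<subseteq> quotient_manifold \<and>
     (\<forall>P\<in>S. \<forall>Q\<in>S. \<exists>\<gamma>. geodesic \<gamma> \<and> \<gamma> 0 = P \<and> \<gamma> 1 = Q \<and> (\<forall>t\<in>{0..1}. \<gamma> t \<in> S))"

definition geodesically_strongly_convex ::
    "((real^'r^'p) set \<Rightarrow> real) \<Rightarrow> (real^'r^'p) set set \<Rightarrow> bool" where
  "geodesically_strongly_convex f S \<longleftrightarrow>
     geodesically_convex S \<and>
     (\<exists>m>0. \<forall>Y. full_column_rank Y \<and> orbit Y \<in> S \<longrightarrow>
        twice_differentiable_at f Y \<and>
        (\<forall>\<theta>\<in>horizontal Y. lifted_hess f Y \<theta> \<ge> m * (norm \<theta>)\<^sup>2))"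

definition geodesically_smooth ::
    "((real^'r^'p) set \<Rightarrow> real) \<Rightarrow> (real^'r^'p) set set \<Rightarrow> bool" where
  "geodesically_smooth f S \<longleftrightarrow>
     S \<subseteq> quotient_manifold \<and>
     (\<exists>L. \<forall>Y. full_column_rank Y \<and> orbit Y \<in> S \<longrightarrow>
        twice_differentiable_at f Y \<and>
        (\<forall>\<theta>\<in>horizontal Y. lifted_hess f Y \<theta> \<le> L * (norm \<theta>)\<^sup>2))"

subsection \<open>The cost function and the region\<close>

text \<open>The expression under \<^const>\<open>the_elem\<close> is constant on an orbit, see \<open>lift_cost\<close>.\<close>

definition cost :: "real^'p^'p \<Rightarrow> (real^'r^'p) set \<Rightarrow> real" where
  "cost Xs P = the_elem ((\<lambda>Y. 1/2 * (norm (Y ** transpose Y - Xs))\<^sup>2) ` P)"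

definition region :: "real^'r^'p \<Rightarrow> real \<Rightarrow> (real^'r^'p) set" where
  "region Ys \<mu> =
     {Y. full_column_rank Y \<and>
         quotient_dist Y Ys \<le> \<mu> * sing_val CARD('r) Ys / cond_number Ys}"

subsection \<open>Consistency facts\<close>

lemma bounded_bilinear_matrix_mult:
  "bounded_bilinear ((**) :: real^'n^'m \<Rightarrow> real^'k^'n \<Rightarrow> real^'k^'m)"
proof -
  have "bilinear ((**) :: real^'n^'m \<Rightarrow> real^'k^'n \<Rightarrow> real^'k^'m)"
    unfolding bilinear_def
    by (auto intro!: linearI
        simp: matrix_matrix_mult_def vec_eq_iff sum.distrib algebra_simps sum_distrib_left)
  then show ?thesis
    by (simp add: bilinear_conv_bounded_bilinear)
qed

lemma bounded_linear_transpose: "bounded_linear (transpose :: real^'n^'m \<Rightarrow> real^'m^'n)"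
  by (rule linear_conv_bounded_linear[THEN iffD1], rule linearI)
    (simp_all add: transpose_def vec_eq_iff)

lemma transpose_add: "transpose (A + B) = transpose A + transpose (B :: real^'n^'m)"
  by (rule linear_add[OF bounded_linear.linear[OF bounded_linear_transpose]])

lemma transpose_diff: "transpose (A - B) = transpose A - transpose (B :: real^'n^'m)"
  by (rule linear_diff[OF bounded_linear.linear[OF bounded_linear_transpose]])

lemma inner_transpose: "inner (transpose A) (transpose B) = inner A (B :: real^'n^'m)"
  unfolding inner_vec_def transpose_def by (simp only: vec_lambda_beta) (rule sum.swap)

lemma inner_matrix_mult_left:
  fixes A :: "real^'n^'m" and B :: "real^'k^'n" and C :: "real^'k^'m"
  shows "inner (A ** B) C = inner A (C ** transpose B)"
proof -
  have "inner (A ** B) C = (\<Sum>i\<in>UNIV. \<Sum>j\<in>UNIV. \<Sum>k\<in>UNIV. A$i$k * B$k$j * C$i$j)"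
    by (simp add: inner_vec_def matrix_matrix_mult_def sum_distrib_right)
  also have "\<dots> = (\<Sum>i\<in>UNIV. \<Sum>k\<in>UNIV. \<Sum>j\<in>UNIV. A$i$k * B$k$j * C$i$j)"
    by (intro sum.cong refl sum.swap)
  also have "\<dots> = inner A (C ** transpose B)"
    by (simp add: inner_vec_def matrix_matrix_mult_def transpose_def sum_distrib_left mult_ac)
  finally show ?thesis .
qed

lemma orbit_nonempty: "Y \<in> orbit Y"
  unfolding orbit_def
  by (rule CollectI, rule exI[of _ "mat 1"]) (simp add: orthogonal_matrix_id)

lemma lift_cost:
  fixes Y :: "real^'r^'p"
  shows "lift (cost Xs) Y = 1/2 * (norm (Y ** transpose Y - Xs))\<^sup>2"
proof -
  have *: "Z ** transpose Z = Y ** transpose Y" if Z: "Z \<in> orbit Y" for Z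
  proof -
    obtain Q where Q: "orthogonal_matrix Q" "Z = Y ** Q"
      using Z unfolding orbit_def by blast
    have "Z ** transpose Z = Y ** (Q ** transpose Q) ** transpose Y"
      by (simp add: Q matrix_transpose_mul matrix_mul_assoc)
    then show ?thesis
      using Q(1) by (simp add: orthogonal_matrix_def)
  qed
  have "(\<lambda>Z. 1/2 * (norm (Z ** transpose Z - Xs))\<^sup>2) ` orbit Y
      = (\<lambda>Z. 1/2 * (norm (Y ** transpose Y - Xs))\<^sup>2) ` orbit Y"
    by (rule image_cong) (simp_all only: *)
  also have "\<dots> = {1/2 * (norm (Y ** transpose Y - Xs))\<^sup>2}"
    by (rule image_constant[OF orbit_nonempty])
  finally show ?thesis
    by (simp only: lift_def cost_def the_elem_eq)
qed

lemma GDERIV_lift_cost: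
  fixes Y :: "real^'r^'p"
  assumes "transpose Xs = Xs"
  shows "GDERIV (lift (cost Xs)) Y :> 2 *\<^sub>R ((Y ** transpose Y - Xs) ** Y)"
proof -
  let ?E = "Y ** transpose Y - Xs"
  have symE: "transpose ?E = ?E"
    by (simp add: transpose_diff matrix_transpose_mul assms)
  have mult: "((\<lambda>Z. Z ** transpose Z) has_derivative (\<lambda>h. Y ** transpose h + h ** transpose Y)) (at Y)"
    using bounded_bilinear.FDERIV[OF bounded_bilinear_matrix_mult has_derivative_ident
        bounded_linear.has_derivative[OF bounded_linear_transpose has_derivative_ident]] .
  have d: "((\<lambda>Z. Z ** transpose Z - Xs) has_derivative (\<lambda>h. Y ** transpose h + h ** transpose Y)) (at Y)"
    by (rule has_derivative_eq_rhs[OF has_derivative_diff[OF mult has_derivative_const]]) simp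
  have "((\<lambda>Z. 1/2 * inner (Z ** transpose Z - Xs) (Z ** transpose Z - Xs)) has_derivative
      (\<lambda>h. 1/2 * (inner ?E (Y ** transpose h + h ** transpose Y)
               + inner (Y ** transpose h + h ** transpose Y) ?E))) (at Y)"
    by (intro has_derivative_mult_right has_derivative_inner d)
  moreover have "1/2 * (inner ?E (Y ** transpose h + h ** transpose Y)
               + inner (Y ** transpose h + h ** transpose Y) ?E)
      = inner h (2 *\<^sub>R (?E ** Y))" for h
  proof -
    have a: "inner (h ** transpose Y) ?E = inner h (?E ** Y)"
      by (simp add: inner_matrix_mult_left)
    have "inner (Y ** transpose h) ?E = inner (transpose (Y ** transpose h)) (transpose ?E)"
      by (simp only: inner_transpose)
    also have "\<dots> = inner (h ** transpose Y) ?E"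
      by (simp only: symE) (simp add: matrix_transpose_mul)
    finally show ?thesis
      using a by (simp add: inner_add_right inner_add_left inner_commute)
  qed
  ultimately show ?thesis
    by (simp add: gderiv_def lift_cost[abs_def] power2_norm_eq_inner)
qed

lemma lifted_grad_cost:
  fixes Y :: "real^'r^'p"
  assumes "transpose Xs = Xs"
  shows "lifted_grad (cost Xs) Y = 2 *\<^sub>R ((Y ** transpose Y - Xs) ** Y)"
  unfolding lifted_grad_def
proof (rule the_equality[where P="\<lambda>D. GDERIV (lift (cost Xs)) Y :> D"])
  show g: "GDERIV (lift (cost Xs)) Y :> 2 *\<^sub>R ((Y ** transpose Y - Xs) ** Y)"
    by (rule GDERIV_lift_cost[OF assms])
  show "D = 2 *\<^sub>R ((Y ** transpose Y - Xs) ** Y)" if "GDERIV (lift (cost Xs)) Y :> D" for D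
  proof -
    have "(\<lambda>h. inner h D) = (\<lambda>h. inner h (2 *\<^sub>R ((Y ** transpose Y - Xs) ** Y)))"
      using g that unfolding gderiv_def by (rule has_derivative_unique[rotated])
    then have "\<forall>h. inner h D = inner h (2 *\<^sub>R ((Y ** transpose Y - Xs) ** Y))"
      by (rule fun_eq_iff[THEN iffD1])
    then show ?thesis
      by (rule vector_eq_ldot[THEN iffD1])
  qed
qed

lemma has_derivative_lifted_grad_cost:
  fixes Y :: "real^'r^'p"
  assumes "transpose Xs = Xs"
  shows "(lifted_grad (cost Xs) has_derivative
    (\<lambda>\<theta>. 2 *\<^sub>R ((Y ** transpose Y - Xs) ** \<theta> + (Y ** transpose \<theta> + \<theta> ** transpose Y) ** Y))) (at Y)"
proof -
  have mult: "((\<lambda>Z. Z ** transpose Z) has_derivative (\<lambda>h. Y ** transpose h + h ** transpose Y)) (at Y)"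
    using bounded_bilinear.FDERIV[OF bounded_bilinear_matrix_mult has_derivative_ident
        bounded_linear.has_derivative[OF bounded_linear_transpose has_derivative_ident]] .
  have d: "((\<lambda>Z. Z ** transpose Z - Xs) has_derivative (\<lambda>h. Y ** transpose h + h ** transpose Y)) (at Y)"
    by (rule has_derivative_eq_rhs[OF has_derivative_diff[OF mult has_derivative_const]]) simp
  show ?thesis
    unfolding lifted_grad_cost[OF assms, abs_def]
    using has_derivative_scaleR_right[OF
        bounded_bilinear.FDERIV[OF bounded_bilinear_matrix_mult d has_derivative_ident]] .
qed

lemma twice_differentiable_at_cost:
  assumes "transpose Xs = Xs"
  shows "twice_differentiable_at (cost Xs) Y"
  unfolding twice_differentiable_at_def
proof
  show "\<forall>\<^sub>F Z in nhds Y. \<exists>D. GDERIV (lift (cost Xs)) Z :> D"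
    using GDERIV_lift_cost[OF assms] by (intro always_eventually allI exI)
  show "lifted_grad (cost Xs) differentiable at Y"
    using has_derivative_lifted_grad_cost[OF assms] unfolding differentiable_def by blast
qed

lemma subspace_horizontal: "subspace (horizontal Y)"
proof -
  have "bounded_linear (\<lambda>\<theta>. transpose (transpose Y ** \<theta>) - transpose Y ** \<theta>)"
    by (intro bounded_linear_sub bounded_linear_compose[OF bounded_linear_transpose]
        bounded_bilinear.bounded_linear_right[OF bounded_bilinear_matrix_mult])
  then have "subspace {\<theta>. transpose (transpose Y ** \<theta>) - transpose Y ** \<theta> = 0}"
    by (intro linear_subspace_kernel bounded_linear.linear)
  then show ?thesis
    by (simp add: horizontal_def)
qed

lemma inner_hor_proj:
  assumes "\<theta> \<in> horizontal Y"
  shows "inner (hor_proj Y A) \<theta> = inner A \<theta>"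
proof -
  let ?S = "horizontal Y" and ?c = "hor_proj Y A"
  have S: "subspace ?S" "closed ?S" "convex ?S"
    using subspace_horizontal closed_subspace subspace_imp_convex by blast+
  have cS: "?c \<in> ?S"
    unfolding hor_proj_def using S assms by (metis closest_point_in_set empty_iff)
  have dot: "inner (A - ?c) (x - ?c) \<le> 0" if "x \<in> ?S" for x
    unfolding hor_proj_def by (rule closest_point_dot[OF S(3,2) that])
  have "inner (A - ?c) \<theta> \<le> 0"
    using dot[of "?c + \<theta>"] S(1) cS assms by (simp add: subspace_add)
  moreover have "inner (A - ?c) (- \<theta>) \<le> 0"
    using dot[of "?c - \<theta>"] S(1) cS assms by (simp add: subspace_diff)
  ultimately show ?thesis
    by (simp add: inner_diff_left)
qed

text \<open>The Riemannian Hessian of the cost function in closed form.\<close>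

lemma lifted_hess_cost:
  fixes Y \<theta> :: "real^'r^'p"
  assumes X: "transpose Xs = Xs" and \<theta>: "\<theta> \<in> horizontal Y"
  shows "lifted_hess (cost Xs) Y \<theta> =
    (norm (Y ** transpose \<theta> + \<theta> ** transpose Y))\<^sup>2
    + 2 * inner (Y ** transpose Y - Xs) (\<theta> ** transpose \<theta>)"
proof -
  let ?E = "Y ** transpose Y - Xs" and ?S = "Y ** transpose \<theta> + \<theta> ** transpose Y"
  have symS: "transpose ?S = ?S"
    by (simp add: transpose_add matrix_transpose_mul add.commute)
  have "lifted_hess (cost Xs) Y \<theta> = 2 * inner (?E ** \<theta>) \<theta> + 2 * inner (?S ** Y) \<theta>"
    by (simp add: lifted_hess_def lifted_hess_op_def inner_hor_proj[OF \<theta>]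
        frechet_derivative_at[OF has_derivative_lifted_grad_cost[OF X], symmetric]
        inner_add_left)
  moreover have "inner (?E ** \<theta>) \<theta> = inner ?E (\<theta> ** transpose \<theta>)"
    by (rule inner_matrix_mult_left)
  moreover have "2 * inner (?S ** Y) \<theta> = (norm ?S)\<^sup>2"
  proof -
    have "inner (?S ** Y) \<theta> = inner ?S (\<theta> ** transpose Y)"
      by (rule inner_matrix_mult_left)
    moreover have "inner ?S (\<theta> ** transpose Y) = inner ?S (Y ** transpose \<theta>)"
    proof -
      have "inner ?S (\<theta> ** transpose Y) = inner (transpose ?S) (transpose (\<theta> ** transpose Y))"
        by (simp only: inner_transpose)
      then show ?thesis
        by (simp only: symS) (simp add: matrix_transpose_mul)
    qed
    moreover have "(norm ?S)\<^sup>2 = inner ?S (Y ** transpose \<theta>) + inner ?S (\<theta> ** transpose Y)"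
      by (simp only: power2_norm_eq_inner inner_add_right)
    ultimately show ?thesis
      by simp
  qed
  ultimately show ?thesis
    by simp
qed

lemma compact_orthogonal_matrices: "compact {Q :: real^'n^'n. orthogonal_matrix Q}"
proof -
  have "continuous_on UNIV (\<lambda>Q :: real^'n^'n. transpose Q ** Q)"
    by (intro bounded_bilinear.continuous_on[OF bounded_bilinear_matrix_mult]
        bounded_linear.continuous_on[OF bounded_linear_transpose] continuous_on_id)
  then have "closed {Q :: real^'n^'n. transpose Q ** Q = mat 1}"
    using continuous_closed_preimage_constant[of UNIV] by auto
  moreover have "norm Q = norm (mat 1 :: real^'n^'n)" if "orthogonal_matrix Q" for Q :: "real^'n^'n"
  proof -
    have "inner Q Q = inner (mat 1 ** Q) Q"
      by simp
    also have "\<dots> = inner (mat 1 :: real^'n^'n) (mat 1)"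
      using that by (simp only: inner_matrix_mult_left orthogonal_matrix_def)
    finally show ?thesis
      by (simp add: norm_eq_sqrt_inner)
  qed
  then have "bounded {Q :: real^'n^'n. orthogonal_matrix Q}"
    unfolding bounded_iff by auto
  ultimately show ?thesis
    by (simp add: compact_eq_bounded_closed orthogonal_matrix)
qed

lemma quotient_dist_attained:
  fixes Y1 Y2 :: "real^'r^'p"
  obtains Q where "orthogonal_matrix Q" "quotient_dist Y1 Y2 = norm (Y2 ** Q - Y1)"
    "\<And>R. orthogonal_matrix R \<Longrightarrow> norm (Y2 ** Q - Y1) \<le> norm (Y2 ** R - Y1)"
proof -
  let ?O = "{Q :: real^'r^'r. orthogonal_matrix Q}" and ?f = "\<lambda>Q. norm (Y2 ** Q - Y1)"
  have "continuous_on ?O ?f"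
    by (intro continuous_on_norm continuous_on_diff continuous_on_const
        bounded_bilinear.continuous_on[OF bounded_bilinear_matrix_mult] continuous_on_id)
  moreover have "?O \<noteq> {}"
    using orthogonal_matrix_id by blast
  ultimately obtain Q where Q: "Q \<in> ?O" "\<And>R. R \<in> ?O \<Longrightarrow> ?f Q \<le> ?f R"
    using continuous_attains_inf[OF compact_orthogonal_matrices] by metis
  have "quotient_dist Y1 Y2 = ?f Q"
    unfolding quotient_dist_def using Q by (intro cInf_eq_minimum) auto
  with Q show ?thesis
    by (intro that) auto
qed

lemma hess_sphere:
  fixes Y :: "real^'r^'p"
  assumes X: "transpose Xs = Xs" and Y: "full_column_rank Y"
  shows "{\<theta> \<in> horizontal Y. norm \<theta> = 1} \<noteq> {}" "compact {\<theta> \<in> horizontal Y. norm \<theta> = 1}"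
    "continuous_on {\<theta> \<in> horizontal Y. norm \<theta> = 1} (lifted_hess (cost Xs) Y)"
proof -
  let ?U = "{\<theta> \<in> horizontal Y. norm \<theta> = 1}"
  have "Y \<noteq> 0"
    using Y by (auto simp: full_column_rank_def)
  moreover have "Y \<in> horizontal Y"
    by (simp add: horizontal_def matrix_transpose_mul)
  ultimately have "(1 / norm Y) *\<^sub>R Y \<in> ?U"
    using subspace_horizontal[of Y] by (auto intro: subspace_scale)
  then show "?U \<noteq> {}"
    by blast
  have "?U = horizontal Y \<inter> sphere 0 1"
    by auto
  then show "compact ?U"
    by (simp add: closed_subspace[OF subspace_horizontal] closed_Int_compact del: sphere_empty)
  have "continuous_on ?U (\<lambda>\<theta>. (norm (Y ** transpose \<theta> + \<theta> ** transpose Y))\<^sup>2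
      + 2 * inner (Y ** transpose Y - Xs) (\<theta> ** transpose \<theta>))"
    by (intro continuous_intros bounded_bilinear.continuous_on[OF bounded_bilinear_matrix_mult]
        bounded_linear.continuous_on[OF bounded_linear_transpose])
  then show "continuous_on ?U (lifted_hess (cost Xs) Y)"
    by (rule continuous_on_eq) (simp add: lifted_hess_cost[OF X])
qed

lemma hess_min_attained:
  fixes Y :: "real^'r^'p"
  assumes X: "transpose Xs = Xs" and Y: "full_column_rank Y"
  obtains \<theta> where "\<theta> \<in> horizontal Y" "norm \<theta> = 1"
    "hess_min (cost Xs) Y = lifted_hess (cost Xs) Y \<theta>"
    "\<And>\<eta>. \<eta> \<in> horizontal Y \<Longrightarrow> norm \<eta> = 1 \<Longrightarrow> lifted_hess (cost Xs) Y \<theta> \<le> lifted_hess (cost Xs) Y \<eta>"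
proof -
  let ?U = "{\<theta> \<in> horizontal Y. norm \<theta> = 1}"
  obtain \<theta> where \<theta>: "\<theta> \<in> ?U" "\<forall>\<eta>\<in>?U. lifted_hess (cost Xs) Y \<theta> \<le> lifted_hess (cost Xs) Y \<eta>"
    using continuous_attains_inf[OF hess_sphere(2,1,3)[OF X Y]] by blast
  have "hess_min (cost Xs) Y = lifted_hess (cost Xs) Y \<theta>"
    unfolding hess_min_def using \<theta> by (intro cInf_eq_minimum) auto
  with \<theta> show ?thesis
    by (intro that) auto
qed

lemma hess_max_attained:
  fixes Y :: "real^'r^'p"
  assumes X: "transpose Xs = Xs" and Y: "full_column_rank Y"
  obtains \<theta> where "\<theta> \<in> horizontal Y" "norm \<theta> = 1"
    "hess_max (cost Xs) Y = lifted_hess (cost Xs) Y \<theta>"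
    "\<And>\<eta>. \<eta> \<in> horizontal Y \<Longrightarrow> norm \<eta> = 1 \<Longrightarrow> lifted_hess (cost Xs) Y \<eta> \<le> lifted_hess (cost Xs) Y \<theta>"
proof -
  let ?U = "{\<theta> \<in> horizontal Y. norm \<theta> = 1}"
  obtain \<theta> where \<theta>: "\<theta> \<in> ?U" "\<forall>\<eta>\<in>?U. lifted_hess (cost Xs) Y \<eta> \<le> lifted_hess (cost Xs) Y \<theta>"
    using continuous_attains_sup[OF hess_sphere(2,1,3)[OF X Y]] by blast
  have "hess_max (cost Xs) Y = lifted_hess (cost Xs) Y \<theta>"
    unfolding hess_max_def using \<theta> by (intro cSup_eq_maximum) auto
  with \<theta> show ?thesis
    by (intro that) auto
qed

end

theory Submission
  imports Defs
begin

text \<open>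
  The Hessian bounds are a perturbation estimate around the representative \<open>S\<close> of \<open>Ystar\<close> nearest
  to \<open>Y\<close>: on horizontal vectors \<open>(norm (Y ** transpose \<theta> + \<theta> ** transpose Y))\<^sup>2\<close> lies between two
  and four times \<open>(norm (Y ** transpose \<theta>))\<^sup>2\<close>, and \<open>Y ** transpose Y - S ** transpose S\<close> is small.

  Geodesics of the quotient are the straight segments between two aligned representatives.  For
  geodesic convexity, align \<open>Y1\<close> and \<open>Y2\<close> with \<open>S\<close>, rotate \<open>Y2\<close> by \<open>Q\<close> into alignment with \<open>Y1\<close>, and
  put \<open>G = Y1 - Y2 ** Q\<close>.  Comparing the segment with \<open>S\<close> and with \<open>S ** Q\<close>, the squared distance to
  the orbit of \<open>S\<close> is convex along it once \<open>norm (S ** (Q - mat 1)) \<le> norm G / 2\<close>, and this holds for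
  balls of radius at most a quarter of the least singular value.  The positivity hypothesis
  on \<open>\<mu>\<close> forces the radius below that threshold.
\<close>

subsection \<open>Spectral theorem and singular values\<close>

declare transpose_matrix_vector [simp del]

lemma inner_matrix_vector_left: "inner (A *v x) y = inner x (transpose A *v y)"
  for A :: "real^'n^'m"
  using dot_lmul_matrix[of y A x] by (simp add: transpose_matrix_vector inner_commute)

lemma norm_orthogonal_matrix_vector:
  assumes "orthogonal_matrix Q" shows "norm (Q *v x) = norm (x :: real^'n)"
  using assms
  by (simp add: norm_eq_sqrt_inner inner_matrix_vector_left matrix_vector_mul_assoc orthogonal_matrix_def)

text \<open>On \<open>V\<close> the form is nonnegative and vanishes at \<open>v\<close>, so
  \<open>v\<close> is a minimiser and the derivative in every direction \<open>w\<close> of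
  \<open>V\<close> must vanish.\<close>

lemma psd_form_kernel:
  fixes f :: "'a::real_inner \<Rightarrow> 'a"
  assumes f: "linear f" and self_adj: "\<And>x y. inner (f x) y = inner x (f y)"
    and V: "subspace V" and psd: "\<And>x. x \<in> V \<Longrightarrow> 0 \<le> inner x (f x)"
    and v: "v \<in> V" "inner v (f v) = 0" and w: "w \<in> V"
  shows "inner (f v) w = 0"
proof (rule ccontr)
  define b c where "b = inner (f v) w" and "c = inner w (f w)"
  assume "inner (f v) w \<noteq> 0"
  then have b: "b\<^sup>2 > 0" by (simp add: b_def)
  have c: "c \<ge> 0" using psd[OF w] by (simp add: c_def)
  \<comment> \<open>Along \<open>v + t *\<^sub>R w\<close> the form equals
    \<open>2 * t * b + t\<^sup>2 * c\<close>, which is negative for this \<open>t\<close>. The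
    denominator \<open>1 + c\<close> avoids a separate case for \<open>c = 0\<close>.\<close>
  define t where "t = - b / (1 + c)"
  have "v + t *\<^sub>R w \<in> V"
    using V v(1) w by (simp add: subspace_add subspace_scale)
  then have "0 \<le> inner (v + t *\<^sub>R w) (f (v + t *\<^sub>R w))"
    by (rule psd)
  also have "\<dots> = 2 * t * b + t\<^sup>2 * c"
    using v(2) self_adj[of w v]
    by (simp add: linear_add[OF f] linear_scale[OF f] inner_add_left inner_add_right b_def c_def
        power2_eq_square inner_commute algebra_simps)
  also have "\<dots> = b\<^sup>2 * (- (2 + c) / (1 + c)\<^sup>2)"
    using c by (simp add: t_def power2_eq_square divide_simps) algebra
  finally show False
    using b c by (simp add: zero_le_mult_iff zero_le_divide_iff)
qed

text \<open>The Rayleigh quotient attains its maximum \<gamma> on the compact unit sphere of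
  \<open>V\<close>. Then \<gamma> times the identity minus \<open>f\<close> is semidefinite on
  \<open>V\<close> and its form vanishes at the maximiser, so it annihilates the maximiser by
  \<open>psd_form_kernel\<close>.\<close>

lemma self_adjoint_max_eigenvector:
  fixes f :: "'a::euclidean_space \<Rightarrow> 'a"
  assumes f: "linear f" and self_adj: "\<And>x y. inner (f x) y = inner x (f y)"
    and V: "subspace V" "f ` V \<subseteq> V" "V \<noteq> {0}"
  obtains v \<gamma> where "v \<in> V" "norm v = 1" "f v = \<gamma> *\<^sub>R v"
    "\<And>x. x \<in> V \<Longrightarrow> inner x (f x) \<le> \<gamma> * (norm x)\<^sup>2"
proof -
  let ?K = "V \<inter> sphere 0 1"
  obtain x where x: "x \<in> V" "x \<noteq> 0"
    using V subspace_0 by blast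
  then have "(1 / norm x) *\<^sub>R x \<in> ?K"
    using V(1) by (simp add: subspace_scale)
  then have "?K \<noteq> {}" by blast
  moreover have "compact ?K"
    using V(1) by (intro closed_Int_compact closed_subspace) auto
  moreover have "continuous_on ?K (\<lambda>x. inner x (f x))"
    using f by (intro continuous_intros linear_continuous_on linear_conv_bounded_linear[THEN iffD1])
  ultimately obtain v where v: "v \<in> ?K" "\<And>x. x \<in> ?K \<Longrightarrow> inner x (f x) \<le> inner v (f v)"
    using continuous_attains_sup by metis
  define \<gamma> where "\<gamma> = inner v (f v)"
  have vV: "v \<in> V" and nv: "norm v = 1" using v(1) by auto
  have max: "inner x (f x) \<le> \<gamma> * (norm x)\<^sup>2" if "x \<in> V" for x
  proof (cases "x = 0")
    case True
    then show ?thesis by (simp add: linear_0[OF f])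
  next
    case False
    have "(1 / norm x) *\<^sub>R x \<in> ?K"
      using V(1) that False by (simp add: subspace_scale)
    from v(2)[OF this] have "inner x (f x) / (norm x)\<^sup>2 \<le> \<gamma>"
      by (simp add: linear_scale[OF f] \<gamma>_def power2_eq_square)
    then show ?thesis
      using False by (simp add: divide_simps split: if_splits)
  qed
  define g where "g x = \<gamma> *\<^sub>R x - f x" for x
  have g: "linear g"
    unfolding g_def using f by (intro linear_compose_sub linear_compose_scale_right linear_ident)
  have "inner (g v) (g v) = 0"
  proof (rule psd_form_kernel[OF g _ V(1)])
    show "inner (g x) y = inner x (g y)" for x y
      by (simp add: g_def inner_diff_left inner_diff_right self_adj)
    show "0 \<le> inner x (g x)" if "x \<in> V" for x
      using max[OF that] by (simp add: g_def inner_diff_right power2_norm_eq_inner)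
    show "inner v (g v) = 0"
      using nv by (simp add: g_def inner_diff_right \<gamma>_def norm_eq_1)
    show "g v \<in> V"
      unfolding g_def using V vV by (intro subspace_diff subspace_scale) auto
  qed fact
  then have "f v = \<gamma> *\<^sub>R v" by (simp add: g_def)
  with vV nv max show ?thesis by (intro that) auto
qed

text \<open>Induction on the dimension: self-adjointness makes the complement within
  \<open>V\<close> of one eigenvector invariant under \<open>f\<close>.\<close>

lemma self_adjoint_orthonormal_eigenbasis:
  fixes f :: "'a::euclidean_space \<Rightarrow> 'a"
  assumes f: "linear f" and self_adj: "\<And>x y. inner (f x) y = inner x (f y)"
    and "subspace V" "f ` V \<subseteq> V"
  shows "\<exists>B. B \<subseteq> V \<and> finite B \<and> card B = dim V \<and> pairwise orthogonal B \<and>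
    (\<forall>v\<in>B. norm v = 1 \<and> (\<exists>\<gamma>. f v = \<gamma> *\<^sub>R v))"
  using assms(3,4)
proof (induction "dim V" arbitrary: V)
  case 0
  then show ?case by (intro exI[of _ "{}"]) auto
next
  case (Suc n V)
  then have "V \<noteq> {0}" by auto
  from self_adjoint_max_eigenvector[OF f self_adj Suc.prems this]
  obtain v \<gamma> where v: "v \<in> V" "norm v = 1" "f v = \<gamma> *\<^sub>R v" by metis
  let ?W = "{y \<in> V. \<forall>x\<in>span {v}. orthogonal x y}"
  have W: "?W = {y \<in> V. inner v y = 0}"
    by (auto simp: span_singleton orthogonal_def)
  have "dim ?W + dim (span {v}) = dim V"
    using Suc.prems(1) v(1) by (intro dim_subspace_orthogonal_to_vectors) (auto intro: span_minimal[THEN subsetD])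
  moreover have "dim (span {v}) = 1"
    using v(2) by (subst dim_span, subst dim_singleton) auto
  ultimately have dW: "dim ?W = n" using Suc.hyps(2) by linarith
  have sW: "subspace ?W"
    unfolding W using Suc.prems(1) by (auto simp: subspace_def inner_add_right)
  have "f ` ?W \<subseteq> ?W"
    unfolding W using Suc.prems(2) v(3) by (auto simp: self_adj[symmetric])
  from Suc.hyps(1)[OF dW[symmetric] sW this] obtain B where
    B: "B \<subseteq> ?W" "finite B" "card B = n" "pairwise orthogonal B"
      "\<forall>v\<in>B. norm v = 1 \<and> (\<exists>\<gamma>. f v = \<gamma> *\<^sub>R v)"
    using dW by auto
  have "v \<notin> B"
    using B(1) v(2) unfolding W by (auto simp: norm_eq_1)
  moreover have "pairwise orthogonal (insert v B)"
    using B(1,4) unfolding W by (auto simp: pairwise_insert orthogonal_def inner_commute)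
  ultimately show ?case
    using B v Suc.hyps(2) by (intro exI[of _ "insert v B"]) auto
qed

lemma symmetric_matrix_diagonalization:
  fixes A :: "real^'n^'n"
  assumes "transpose A = A"
  obtains P d where "orthogonal_matrix P" "A ** P = P ** (\<chi> i j. if i = j then d i else 0)"
proof -
  have "\<exists>B. B \<subseteq> UNIV \<and> finite B \<and> card B = dim (UNIV::(real^'n) set) \<and> pairwise orthogonal B \<and>
      (\<forall>v\<in>B. norm v = 1 \<and> (\<exists>\<gamma>. A *v v = \<gamma> *\<^sub>R v))"
  proof (rule self_adjoint_orthonormal_eigenbasis)
    show "inner (A *v x) y = inner x (A *v y)" for x y
      by (simp add: inner_matrix_vector_left assms)
  qed auto
  then obtain B where B: "finite B" "card B = CARD('n)" "pairwise orthogonal B"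
      "\<forall>v\<in>B. norm v = 1 \<and> (\<exists>\<gamma>. A *v v = \<gamma> *\<^sub>R v)"
    by auto
  obtain b :: "'n \<Rightarrow> real^'n" where b: "bij_betw b UNIV B"
    using finite_same_card_bij[of "UNIV :: 'n set" B] B(1,2) by auto
  then have bB: "b i \<in> B" for i
    by (auto simp: bij_betw_def)
  then have "\<forall>i. \<exists>\<gamma>. A *v b i = \<gamma> *\<^sub>R b i"
    using B(4) by blast
  then obtain d where d: "A *v b i = d i *\<^sub>R b i" for i
    by metis
  define P :: "real^'n^'n" where "P = (\<chi> i j. b j $ i)"
  have col: "column j P = b j" for j
    by (simp add: P_def column_def vec_eq_iff)
  have "orthogonal_matrix P"
    unfolding orthogonal_matrix_orthonormal_columns col
  proof (intro conjI allI impI)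
    show "norm (b i) = 1" for i
      using B(4) bB by blast
    show "orthogonal (b i) (b j)" if "i \<noteq> j" for i j
    proof -
      have "b i \<noteq> b j"
        using b that unfolding bij_betw_def inj_def by metis
      then show ?thesis
        using B(3) bB unfolding pairwise_def by blast
    qed
  qed
  moreover have "(A ** P) $ i $ j = (P ** (\<chi> i j. if i = j then d i else 0)) $ i $ j" for i j
  proof -
    have "(A ** P) $ i $ j = (A *v b j) $ i"
      by (simp add: matrix_matrix_mult_def matrix_vector_mult_def P_def)
    also have "\<dots> = b j $ i * d j"
      by (simp add: d)
    finally show ?thesis
      by (simp add: matrix_matrix_mult_def P_def if_distrib cong: if_cong)
  qed
  then have "A ** P = P ** (\<chi> i j. if i = j then d i else 0)"
    by (simp add: vec_eq_iff)
  ultimately show ?thesis by (rule that)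
qed

section \<open>Singular values as extreme stretch factors\<close>

text \<open>Similarity invariance of the characteristic polynomial, carried out over the polynomial
  ring: \<open>c\<close> embeds real matrices as constant ones, and the scalar matrix
  \<open>X\<close> commutes with everything.\<close>

lemma charpoly_diagonalized:
  fixes A P :: "real^'n^'n"
  assumes P: "orthogonal_matrix P" and AP: "A ** P = P ** (\<chi> i j. if i = j then d i else 0)"
  shows "charpoly A = (\<Prod>i\<in>UNIV. [:- d i, 1:])"
proof -
  define c :: "real^'n^'n \<Rightarrow> real poly^'n^'n" where "c M = (\<chi> i j. [:M $ i $ j:])" for M
  define X :: "real poly^'n^'n" where "X = (\<chi> i j. if i = j then [:0, 1:] else 0)"
  define D :: "real^'n^'n" where "D = (\<chi> i j. if i = j then d i else 0)"
  have const_sum: "[:sum g T:] = (\<Sum>k\<in>T. [:g k:])" for g :: "'n \<Rightarrow> real" and T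
    by (rule poly_eqI) (simp add: coeff_sum coeff_pCons split: nat.split)
  have c_mult: "c (M ** N) = c M ** c N" for M N
    by (simp add: c_def matrix_matrix_mult_def vec_eq_iff const_sum mult.commute)
  have c_one: "c (mat 1) = mat 1"
    by (simp add: c_def mat_def vec_eq_iff one_pCons)
  have X_comm: "X ** M = M ** X" for M
    by (simp add: X_def matrix_matrix_mult_def vec_eq_iff if_distrib if_distribR sum.delta
        sum.delta' mult.commute cong: if_cong)
  have diff: "(M - M') ** N = M ** N - M' ** N" "N ** (M - M') = N ** M - N ** M'" for M M' N :: "real poly^'n^'n"
    by (simp_all add: matrix_matrix_mult_def vec_eq_iff left_diff_distrib right_diff_distrib sum_subtractf)
  have cp: "charpoly M = det (X - c M)" for M
    unfolding charpoly_def X_def c_def by (rule arg_cong[of _ _ det]) (simp add: vec_eq_iff)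
  have PP: "P ** transpose P = mat 1" and "transpose P ** P = mat 1"
    using P by (auto simp: orthogonal_matrix_def)
  have "(X - c A) ** c P = c P ** (X - c D)"
    using AP by (simp add: diff X_comm c_mult[symmetric] D_def)
  \<comment> \<open>No inverse matrix is formed: polynomials over a field have no zero divisors, so
    a nonzero \<open>det (c P)\<close> cancels.\<close>
  then have "det (X - c A) * det (c P) = det (c P) * det (X - c D)"
    by (metis det_mul)
  moreover have "det (c P) * det (c (transpose P)) = 1"
    by (metis det_mul c_mult PP c_one det_I)
  then have "det (c P) \<noteq> 0" by auto
  ultimately have "charpoly A = det (X - c D)"
    by (simp add: cp)
  also have "\<dots> = (\<Prod>i\<in>UNIV. [:- d i, 1:])"
    by (subst det_diagonal) (auto simp: X_def c_def D_def)
  finally show ?thesis .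
qed

lemma norm_mult_gram_eigenbasis:
  fixes Y :: "real^'r^'p" and P :: "real^'r^'r"
  assumes P: "orthogonal_matrix P"
    and YP: "(transpose Y ** Y) ** P = P ** (\<chi> i j. if i = j then d i else 0)"
  shows "(norm (Y *v x))\<^sup>2 = (\<Sum>i\<in>UNIV. d i * ((transpose P *v x) $ i)\<^sup>2)"
proof -
  let ?D = "\<chi> i j. if i = j then d i else 0" and ?y = "transpose P *v x"
  have x: "x = P *v ?y"
    using P by (simp only: matrix_vector_mul_assoc orthogonal_matrix_def matrix_vector_mul_lid)
  have "(norm (Y *v x))\<^sup>2 = inner x ((transpose Y ** Y) *v x)"
    by (simp add: power2_norm_eq_inner inner_matrix_vector_left matrix_vector_mul_assoc)
  also have "\<dots> = inner x (P *v (?D *v ?y))"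
    by (subst (2) x) (simp only: matrix_vector_mul_assoc YP matrix_mul_assoc)
  also have "\<dots> = inner ?y (?D *v ?y)"
    using inner_matrix_vector_left[of P "?D *v ?y" x] by (simp add: inner_commute)
  also have "\<dots> = (\<Sum>i\<in>UNIV. d i * (?y $ i)\<^sup>2)"
    by (simp add: inner_vec_def matrix_vector_mult_def if_distrib if_distribR power2_eq_square
        sum.delta mult_ac cong: if_cong)
  finally show ?thesis .
qed

text \<open>In an eigenbasis of the Gram matrix the squared norm of \<open>Y *v x\<close> is a
  weighted sum of squares, with weights between the extreme eigenvalues. From here on singular
  values enter only through these inequalities, not through the characteristic polynomial.\<close>

lemma singular_value_bounds:
  fixes Y :: "real^'r^'p"
  shows "0 \<le> sing_val CARD('r) Y" "sing_val CARD('r) Y \<le> sing_val 1 Y"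
    "sing_val CARD('r) Y * norm x \<le> norm (Y *v x)" "norm (Y *v x) \<le> sing_val 1 Y * norm x"
    "full_column_rank Y \<Longrightarrow> 0 < sing_val CARD('r) Y"
proof -
  have "transpose (transpose Y ** Y) = transpose Y ** Y"
    by (simp add: matrix_transpose_mul)
  then obtain P d where P: "orthogonal_matrix P"
    and YP: "(transpose Y ** Y) ** P = P ** (\<chi> i j. if i = j then d i else 0)"
    by (rule symmetric_matrix_diagonalization)
  note norm_Y = norm_mult_gram_eigenbasis[OF P YP]
  have inv: "transpose P *v (P *v z) = z" for z
    using P by (simp add: matrix_vector_mul_assoc orthogonal_matrix_def)
  \<comment> \<open>Each eigenvalue is the squared norm of the image of a column of
    \<open>P\<close>. This gives nonnegativity, and strict positivity at full rank.\<close>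
  have d: "(norm (Y *v (P *v axis i 1)))\<^sup>2 = d i" for i
    unfolding norm_Y inv by (simp add: axis_def if_distrib if_distribR cong: if_cong)
  then have d_nonneg: "d i \<ge> 0" for i
    by (metis zero_le_power2)
  have "proots (charpoly (transpose Y ** Y)) = (\<Sum>i\<in>UNIV. {#d i#})"
    by (simp add: charpoly_diagonalized[OF P YP] proots_prod)
  then have "image_mset sqrt (proots (charpoly (transpose Y ** Y))) = image_mset (\<lambda>i. sqrt (d i)) (mset_set UNIV)"
    by (simp add: sum_unfold_sum_mset image_mset.compositionality o_def)
  then have sv: "singular_values Y = rev (sorted_list_of_multiset (image_mset (\<lambda>i. sqrt (d i)) (mset_set UNIV)))"
    by (simp add: singular_values_def)
  define l where "l = sorted_list_of_multiset (image_mset (\<lambda>i. sqrt (d i)) (mset_set UNIV))"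
  have l: "mset l = image_mset (\<lambda>i. sqrt (d i)) (mset_set UNIV)" "sorted l"
    by (simp_all add: l_def)
  have len: "length l = CARD('r)"
    by (metis l(1) size_mset size_image_mset size_mset_set)
  have set_l: "set l = range (\<lambda>i. sqrt (d i))"
    by (metis l(1) set_image_mset set_mset_mset finite_set_mset_mset_set finite)
  have r: "CARD('r) > 0" by simp
  \<comment> \<open>\<open>l\<close> is increasing and \<open>singular_values\<close> reverses it,
    so index 1 is the last entry of \<open>l\<close> and index \<open>CARD('r)\<close> the
    first.\<close>
  have s_max: "sing_val 1 Y = l ! (CARD('r) - 1)" and s_min: "sing_val CARD('r) Y = l ! 0"
    using r len by (simp_all add: sing_val_def sv l_def[symmetric] rev_nth)
  have ge: "sing_val CARD('r) Y \<le> sqrt (d i)" and le: "sqrt (d i) \<le> sing_val 1 Y" for i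
  proof -
    have "sqrt (d i) \<in> set l" by (simp add: set_l)
    then obtain k where "k < CARD('r)" "sqrt (d i) = l ! k"
      by (metis in_set_conv_nth len)
    then show "sing_val CARD('r) Y \<le> sqrt (d i)" "sqrt (d i) \<le> sing_val 1 Y"
      using l(2) len unfolding s_max s_min by (auto intro!: sorted_nth_mono)
  qed
  have "l ! 0 \<in> set l" using len r by (intro nth_mem) linarith
  then obtain i0 where i0: "sing_val CARD('r) Y = sqrt (d i0)"
    by (auto simp: set_l s_min)
  show nonneg: "0 \<le> sing_val CARD('r) Y"
    by (simp add: i0 d_nonneg)
  show le_max: "sing_val CARD('r) Y \<le> sing_val 1 Y"
    using ge[of i0] le[of i0] by linarith
  have norm_inv: "(norm x)\<^sup>2 = (\<Sum>i\<in>UNIV. ((transpose P *v x) $ i)\<^sup>2)"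
  proof -
    have "(norm (transpose P *v x))\<^sup>2 = (norm x)\<^sup>2"
      using P by (simp add: norm_orthogonal_matrix_vector)
    then show ?thesis
      by (simp add: norm_vec_def L2_set_def sum_nonneg)
  qed
  have "(sing_val CARD('r) Y * norm x)\<^sup>2 \<le> (norm (Y *v x))\<^sup>2"
    unfolding norm_Y power_mult_distrib norm_inv sum_distrib_left
    using power_mono[OF ge nonneg, where n = 2] d_nonneg
    by (intro sum_mono mult_right_mono) auto
  then show "sing_val CARD('r) Y * norm x \<le> norm (Y *v x)"
    by (rule power2_le_imp_le) simp
  have "(norm (Y *v x))\<^sup>2 \<le> (sing_val 1 Y * norm x)\<^sup>2"
    unfolding norm_Y power_mult_distrib norm_inv sum_distrib_left
    using power_mono[OF le, where n = 2] d_nonneg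
    by (intro sum_mono mult_right_mono) auto
  then show "norm (Y *v x) \<le> sing_val 1 Y * norm x"
    by (rule power2_le_imp_le) (intro mult_nonneg_nonneg order_trans[OF nonneg le_max] norm_ge_zero)
  show "0 < sing_val CARD('r) Y" if "full_column_rank Y"
  proof -
    have "P *v axis i0 1 \<noteq> 0"
    proof
      assume "P *v axis i0 1 = 0"
      then have "axis i0 1 = (0 :: real^'r)"
        using inv[of "axis i0 1"] by simp
      then show False by simp
    qed
    then have "Y *v (P *v axis i0 1) \<noteq> 0"
      using that matrix_nonfull_linear_equations_eq[of Y] unfolding full_column_rank_def by blast
    then have "0 < (norm (Y *v (P *v axis i0 1)))\<^sup>2"
      by simp
    then show ?thesis
      unfolding d i0 by simp
  qed
qed

subsection \<open>Frobenius norm estimates\<close>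

lemmas matrix_mult_linear_simps =
  bounded_bilinear.add_left[OF bounded_bilinear_matrix_mult]
  bounded_bilinear.add_right[OF bounded_bilinear_matrix_mult]
  bounded_bilinear.diff_left[OF bounded_bilinear_matrix_mult]
  bounded_bilinear.diff_right[OF bounded_bilinear_matrix_mult]
  bounded_bilinear.minus_left[OF bounded_bilinear_matrix_mult]
  bounded_bilinear.minus_right[OF bounded_bilinear_matrix_mult]
  bounded_bilinear.scaleR_left[OF bounded_bilinear_matrix_mult]
  bounded_bilinear.scaleR_right[OF bounded_bilinear_matrix_mult]

lemma inner_matrix_mult_right:
  fixes A :: "real^'n^'m" and B :: "real^'k^'n" and C :: "real^'k^'m"
  shows "inner (A ** B) C = inner B (transpose A ** C)"
proof -
  have "inner (A ** B) C = inner (transpose B ** transpose A) (transpose C)"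
    by (simp only: matrix_transpose_mul[symmetric] inner_transpose)
  also have "\<dots> = inner (transpose B) (transpose (transpose A ** C))"
    by (simp only: inner_matrix_mult_left matrix_transpose_mul)
  also have "\<dots> = inner B (transpose A ** C)"
    by (rule inner_transpose)
  finally show ?thesis .
qed

lemma norm_matrix_transpose: "norm (transpose A) = norm (A :: real^'n^'m)"
  by (simp add: norm_eq_sqrt_inner inner_transpose)

lemma norm_matrix_mult_orthogonal:
  fixes A :: "real^'n^'m"
  assumes "orthogonal_matrix Q"
  shows "norm (A ** Q) = norm A"
  using assms
  by (simp add: norm_eq_sqrt_inner inner_matrix_mult_left matrix_mul_assoc[symmetric] orthogonal_matrix_def)

text \<open>Splitting by columns transfers stretch bounds of \<open>A\<close> on vectors to
  Frobenius bounds on \<open>A ** B\<close>. This keeps operator bounds available where the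
  Frobenius norm of \<open>A\<close> would be too lossy.\<close>

lemma norm_matrix_mult_columns:
  fixes A :: "real^'n^'m" and B :: "real^'k^'n"
  shows "(norm (A ** B))\<^sup>2 = (\<Sum>j\<in>UNIV. (norm (A *v column j B))\<^sup>2)"
proof -
  have "(norm (A ** B))\<^sup>2 = (norm (transpose (A ** B)))\<^sup>2"
    by (simp add: norm_matrix_transpose)
  also have "\<dots> = (\<Sum>j\<in>UNIV. (norm (transpose (A ** B) $ j))\<^sup>2)"
    by (simp add: norm_vec_def[of "transpose (A ** B)"] L2_set_def sum_nonneg)
  also have "\<dots> = (\<Sum>j\<in>UNIV. (norm (A *v column j B))\<^sup>2)"
    by (rule sum.cong)
      (simp_all add: transpose_def matrix_matrix_mult_def matrix_vector_mult_def column_def)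
  finally show ?thesis .
qed

lemma norm_matrix_columns: "(norm B)\<^sup>2 = (\<Sum>j\<in>UNIV. (norm (column j B))\<^sup>2)" for B :: "real^'k^'n"
  using norm_matrix_mult_columns[of "mat 1" B] by simp

lemma norm_matrix_mult_le:
  fixes A :: "real^'n^'m" and B :: "real^'k^'n"
  assumes "\<And>x. norm (A *v x) \<le> a * norm x" "0 \<le> a"
  shows "norm (A ** B) \<le> a * norm B"
proof (rule power2_le_imp_le)
  show "(norm (A ** B))\<^sup>2 \<le> (a * norm B)\<^sup>2"
    unfolding norm_matrix_mult_columns power_mult_distrib norm_matrix_columns[of B] sum_distrib_left
    by (intro sum_mono) (metis assms(1) norm_ge_zero power_mono power_mult_distrib)
qed (simp add: assms(2))

lemma norm_matrix_mult_ge: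
  fixes A :: "real^'n^'m" and B :: "real^'k^'n"
  assumes "\<And>x. a * norm x \<le> norm (A *v x)" "0 \<le> a"
  shows "a * norm B \<le> norm (A ** B)"
proof (rule power2_le_imp_le)
  show "(a * norm B)\<^sup>2 \<le> (norm (A ** B))\<^sup>2"
    unfolding norm_matrix_mult_columns power_mult_distrib norm_matrix_columns[of B] sum_distrib_left
    by (intro sum_mono) (metis assms mult_nonneg_nonneg norm_ge_zero power_mono power_mult_distrib)
qed simp

lemma norm_matrix_vector_le_Frobenius: "norm (A *v x) \<le> norm A * norm x" for A :: "real^'n^'m"
proof (rule power2_le_imp_le)
  have "(norm (A *v x))\<^sup>2 = (\<Sum>i\<in>UNIV. (inner (A $ i) x)\<^sup>2)"
    by (simp add: norm_vec_def L2_set_def sum_nonneg matrix_mult_dot)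
  also have "\<dots> \<le> (\<Sum>i\<in>UNIV. (norm (A $ i))\<^sup>2 * (norm x)\<^sup>2)"
    by (intro sum_mono) (metis Cauchy_Schwarz_ineq power2_norm_eq_inner)
  also have "\<dots> = (norm A * norm x)\<^sup>2"
    by (simp add: norm_vec_def[of A] L2_set_def sum_nonneg power_mult_distrib sum_distrib_right)
  finally show "(norm (A *v x))\<^sup>2 \<le> (norm A * norm x)\<^sup>2" .
qed simp

lemma norm_matrix_mult_le_Frobenius: "norm (A ** B) \<le> norm A * norm B"
  for A :: "real^'n^'m" and B :: "real^'k^'n"
  by (rule norm_matrix_mult_le[OF norm_matrix_vector_le_Frobenius norm_ge_zero])

subsection \<open>The region\<close>

lemma quotient_dist_minimizer:
  fixes Y1 Y2 :: "real^'r^'p"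
  shows "\<exists>Q. orthogonal_matrix Q \<and> quotient_dist Y1 Y2 = norm (Y2 ** Q - Y1) \<and>
    (\<forall>R. orthogonal_matrix R \<longrightarrow> norm (Y2 ** Q - Y1) \<le> norm (Y2 ** R - Y1))"
  by (rule quotient_dist_attained[of Y1 Y2]) blast

lemma quotient_dist_le_iff:
  fixes Y1 Y2 :: "real^'r^'p"
  shows "quotient_dist Y1 Y2 \<le> \<delta> \<longleftrightarrow> (\<exists>Q. orthogonal_matrix Q \<and> norm (Y2 ** Q - Y1) \<le> \<delta>)"
proof
  obtain Q where Q: "orthogonal_matrix Q" "quotient_dist Y1 Y2 = norm (Y2 ** Q - Y1)"
    "\<And>R. orthogonal_matrix R \<Longrightarrow> norm (Y2 ** Q - Y1) \<le> norm (Y2 ** R - Y1)"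
    using quotient_dist_minimizer[of Y1 Y2] by blast
  show "\<exists>Q. orthogonal_matrix Q \<and> norm (Y2 ** Q - Y1) \<le> \<delta>" if "quotient_dist Y1 Y2 \<le> \<delta>"
    using Q(1,2) that by auto
  show "quotient_dist Y1 Y2 \<le> \<delta>" if "\<exists>Q. orthogonal_matrix Q \<and> norm (Y2 ** Q - Y1) \<le> \<delta>"
    using Q(2,3) that by (auto intro: order_trans)
qed

lemma orbit_mult_orthogonal:
  fixes Y :: "real^'r^'p"
  assumes Q: "orthogonal_matrix Q"
  shows "orbit (Y ** Q) = orbit Y"
proof -
  have sub: "orbit (Z ** R) \<subseteq> orbit Z" if "orthogonal_matrix R" for Z :: "real^'r^'p" and R
    using that unfolding orbit_def
    by (auto simp: matrix_mul_assoc[symmetric] intro: orthogonal_matrix_mul)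
  have "Y ** Q ** transpose Q = Y"
    using Q by (simp add: matrix_mul_assoc[symmetric] orthogonal_matrix_def)
  then show ?thesis
    using sub[OF Q, of Y] sub[of "transpose Q" "Y ** Q"] Q by auto
qed

text \<open>Strong convexity and smoothness quantify over all full-rank matrices whose orbit lies in
  the image of the region; this brings each of them back to the region, where the Hessian bounds
  apply.\<close>

lemma region_orbit_invariant:
  fixes Y :: "real^'r^'p"
  assumes "full_column_rank Y" "orbit Y \<in> orbit ` region Ys \<mu>"
  shows "Y \<in> region Ys \<mu>"
proof -
  obtain Z where Z: "Z \<in> region Ys \<mu>" "orbit Y = orbit Z"
    using assms(2) by blast
  then obtain Q where Q: "orthogonal_matrix Q" "Y = Z ** Q"
    using orbit_nonempty[of Y] unfolding orbit_def by auto
  obtain R where R: "orthogonal_matrix R" "norm (Ys ** R - Z) \<le> \<mu> * sing_val CARD('r) Ys / cond_number Ys"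
    using Z(1) unfolding region_def quotient_dist_le_iff by blast
  have "norm (Ys ** (R ** Q) - Y) = norm ((Ys ** R - Z) ** Q)"
    by (simp add: Q(2) matrix_mult_linear_simps matrix_mul_assoc)
  also have "\<dots> = norm (Ys ** R - Z)"
    using Q(1) by (rule norm_matrix_mult_orthogonal)
  finally show ?thesis
    using assms(1) R orthogonal_matrix_mul[OF R(1) Q(1)] unfolding region_def quotient_dist_le_iff
    by (intro CollectI conjI exI[of _ "R ** Q"]) simp_all
qed

subsection \<open>Bounds on the Hessian\<close>

lemma perturbed_matrix_vector_bounds:
  fixes S Y :: "real^'r^'p"
  assumes "norm (Y - S) \<le> \<delta>"
  shows "norm (Y *v x) \<le> norm (S *v x) + \<delta> * norm x" "norm (S *v x) - \<delta> * norm x \<le> norm (Y *v x)"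
proof -
  have "norm ((Y - S) *v x) \<le> \<delta> * norm x"
    using norm_matrix_vector_le_Frobenius[of "Y - S" x] assms
    by (meson mult_right_mono norm_ge_zero order_trans)
  moreover have "Y *v x = S *v x + (Y - S) *v x"
    by (simp add: matrix_vector_mult_diff_rdistrib)
  ultimately show "norm (Y *v x) \<le> norm (S *v x) + \<delta> * norm x"
      "norm (S *v x) - \<delta> * norm x \<le> norm (Y *v x)"
    using norm_triangle_ineq[of "S *v x" "(Y - S) *v x"] norm_triangle_ineq2[of "S *v x" "- ((Y - S) *v x)"]
    by simp_all
qed

text \<open>With \<open>E = Y - S\<close> the difference is \<open>S ** transpose E\<close>, its
  transpose and \<open>E ** transpose E\<close>. The two first-order terms cost only the stretch
  bound \<sigma> of \<open>S\<close>.\<close>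

lemma norm_gram_diff_le:
  fixes S Y :: "real^'r^'p"
  assumes S: "\<And>x. norm (S *v x) \<le> \<sigma> * norm x" "0 \<le> \<sigma>" and Y: "norm (Y - S) \<le> \<delta>"
  shows "norm (Y ** transpose Y - S ** transpose S) \<le> 2 * \<sigma> * \<delta> + \<delta>\<^sup>2"
proof -
  define E where "E = Y - S"
  have "Y ** transpose Y - S ** transpose S = S ** transpose E + transpose (S ** transpose E) + E ** transpose E"
    by (simp add: E_def matrix_mult_linear_simps transpose_diff matrix_transpose_mul)
  moreover have "norm (S ** transpose E) \<le> \<sigma> * \<delta>"
    using norm_matrix_mult_le[OF S, of "transpose E"] Y S(2)
    by (metis E_def mult_left_mono norm_matrix_transpose order_trans)
  moreover have "norm (E ** transpose E) \<le> \<delta>\<^sup>2"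
    using norm_matrix_mult_le_Frobenius[of E "transpose E"] Y power_mono[OF Y, of 2]
    by (simp add: E_def norm_matrix_transpose power2_eq_square)
  ultimately show ?thesis
    using norm_triangle_ineq[of "S ** transpose E + transpose (S ** transpose E)" "E ** transpose E"]
      norm_triangle_ineq[of "S ** transpose E" "transpose (S ** transpose E)"]
    by (simp add: norm_matrix_transpose)
qed

text \<open>Horizontality turns the cross term of the expanded square into the squared norm of
  \<open>transpose Y ** \<theta>\<close>. It is therefore nonnegative, and Cauchy-Schwarz bounds it
  by the squared norm of \<open>Y ** transpose \<theta>\<close>.\<close>

lemma norm_symmetrized_product_bounds:
  fixes Y \<theta> :: "real^'r^'p"
  assumes "\<theta> \<in> horizontal Y"
  shows "2 * (norm (Y ** transpose \<theta>))\<^sup>2 \<le> (norm (Y ** transpose \<theta> + \<theta> ** transpose Y))\<^sup>2"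
    "(norm (Y ** transpose \<theta> + \<theta> ** transpose Y))\<^sup>2 \<le> 4 * (norm (Y ** transpose \<theta>))\<^sup>2"
proof -
  let ?A = "Y ** transpose \<theta>"
  have T: "\<theta> ** transpose Y = transpose ?A"
    by (simp add: matrix_transpose_mul)
  have h: "transpose \<theta> ** Y = transpose Y ** \<theta>"
    using assms by (simp add: horizontal_def matrix_transpose_mul)
  have sq: "(norm (?A + transpose ?A))\<^sup>2 = 2 * (norm ?A)\<^sup>2 + 2 * inner ?A (transpose ?A)"
    by (simp add: power2_norm_eq_inner inner_add_left inner_add_right inner_transpose inner_commute)
  have "inner ?A (transpose ?A) = inner (transpose ?A) ?A"
    by (rule inner_commute)
  also have "\<dots> = inner \<theta> (Y ** (transpose \<theta> ** Y))"
    by (simp add: matrix_transpose_mul inner_matrix_mult_left matrix_mul_assoc)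
  also have "\<dots> = inner (Y ** (transpose Y ** \<theta>)) \<theta>"
    by (simp add: h inner_commute)
  also have "\<dots> = inner (transpose Y ** \<theta>) (transpose Y ** \<theta>)"
    by (rule inner_matrix_mult_right)
  finally have "0 \<le> inner ?A (transpose ?A)"
    by simp
  moreover have "inner ?A (transpose ?A) \<le> (norm ?A)\<^sup>2"
    using norm_cauchy_schwarz[of ?A "transpose ?A"] by (simp add: norm_matrix_transpose power2_eq_square)
  ultimately show "2 * (norm ?A)\<^sup>2 \<le> (norm (?A + \<theta> ** transpose Y))\<^sup>2"
      "(norm (?A + \<theta> ** transpose Y))\<^sup>2 \<le> 4 * (norm ?A)\<^sup>2"
    unfolding T sq by simp_all
qed

lemma lifted_hess_cost_bounds:
  fixes S Y \<theta> :: "real^'r^'p"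
  assumes lower: "\<And>x. s * norm x \<le> norm (S *v x)" and upper: "\<And>x. norm (S *v x) \<le> \<sigma> * norm x"
    and nonneg: "0 \<le> \<sigma>" "0 \<le> \<delta>" "\<delta> \<le> s" and Y: "norm (Y - S) \<le> \<delta>" and \<theta>: "\<theta> \<in> horizontal Y"
  shows "(2 * (s - \<delta>)\<^sup>2 - 2 * (2 * \<sigma> * \<delta> + \<delta>\<^sup>2)) * (norm \<theta>)\<^sup>2 \<le> lifted_hess (cost (S ** transpose S)) Y \<theta>"
    "lifted_hess (cost (S ** transpose S)) Y \<theta> \<le> (4 * (\<sigma> + \<delta>)\<^sup>2 + 2 * (2 * \<sigma> * \<delta> + \<delta>\<^sup>2)) * (norm \<theta>)\<^sup>2"
proof -
  let ?A = "Y ** transpose \<theta>" and ?E = "Y ** transpose Y - S ** transpose S"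
  have hess: "lifted_hess (cost (S ** transpose S)) Y \<theta> =
      (norm (?A + \<theta> ** transpose Y))\<^sup>2 + 2 * inner ?E (\<theta> ** transpose \<theta>)"
    using \<theta> by (intro lifted_hess_cost) (simp add: matrix_transpose_mul)
  have "\<bar>inner ?E (\<theta> ** transpose \<theta>)\<bar> \<le> norm ?E * norm (\<theta> ** transpose \<theta>)"
    by (rule Cauchy_Schwarz_ineq2)
  also have "\<dots> \<le> (2 * \<sigma> * \<delta> + \<delta>\<^sup>2) * (norm \<theta>)\<^sup>2"
    using norm_gram_diff_le[OF upper nonneg(1) Y] norm_matrix_mult_le_Frobenius[of \<theta> "transpose \<theta>"] nonneg
    by (intro mult_mono) (auto simp: norm_matrix_transpose power2_eq_square)
  finally have E: "\<bar>inner ?E (\<theta> ** transpose \<theta>)\<bar> \<le> (2 * \<sigma> * \<delta> + \<delta>\<^sup>2) * (norm \<theta>)\<^sup>2" .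
  have "(s - \<delta>) * norm x \<le> norm (Y *v x)" "norm (Y *v x) \<le> (\<sigma> + \<delta>) * norm x" for x
    using lower[of x] upper[of x] perturbed_matrix_vector_bounds[OF Y, of x] by (auto simp: algebra_simps)
  then have "(s - \<delta>) * norm (transpose \<theta>) \<le> norm ?A" "norm ?A \<le> (\<sigma> + \<delta>) * norm (transpose \<theta>)"
    using nonneg by (auto intro!: norm_matrix_mult_ge norm_matrix_mult_le)
  then have "((s - \<delta>) * norm \<theta>)\<^sup>2 \<le> (norm ?A)\<^sup>2" "(norm ?A)\<^sup>2 \<le> ((\<sigma> + \<delta>) * norm \<theta>)\<^sup>2"
    using nonneg by (auto simp: norm_matrix_transpose intro!: power_mono)
  \<comment> \<open>Naming the squared norms and the inner product as real variables leaves
    inequalities that are linear once products are expanded.\<close>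
  moreover have arith: "a * n \<le> m \<Longrightarrow> 2 * m \<le> h \<Longrightarrow> \<bar>i\<bar> \<le> e * n \<Longrightarrow> (2 * a - 2 * e) * n \<le> h + 2 * i"
      "m \<le> a * n \<Longrightarrow> h \<le> 4 * m \<Longrightarrow> \<bar>i\<bar> \<le> e * n \<Longrightarrow> h + 2 * i \<le> (4 * a + 2 * e) * n"
      for a e n m h i :: real
    by (auto simp: algebra_simps)
  ultimately show "(2 * (s - \<delta>)\<^sup>2 - 2 * (2 * \<sigma> * \<delta> + \<delta>\<^sup>2)) * (norm \<theta>)\<^sup>2 \<le> lifted_hess (cost (S ** transpose S)) Y \<theta>"
      "lifted_hess (cost (S ** transpose S)) Y \<theta> \<le> (4 * (\<sigma> + \<delta>)\<^sup>2 + 2 * (2 * \<sigma> * \<delta> + \<delta>\<^sup>2)) * (norm \<theta>)\<^sup>2"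
    using norm_symmetrized_product_bounds[OF \<theta>] E arith unfolding hess power_mult_distrib
    by blast+
qed

subsection \<open>Optimal alignment of representatives\<close>

definition outer :: "real^'n \<Rightarrow> real^'m \<Rightarrow> real^'m^'n" where
  "outer u v = (\<chi> i j. u $ i * v $ j)"

lemma transpose_outer: "transpose (outer u v) = outer v u"
  by (simp add: outer_def transpose_def vec_eq_iff mult.commute)

lemma outer_mult_outer: "outer u v ** outer x y = inner v x *\<^sub>R outer u y"
  by (simp add: outer_def matrix_matrix_mult_def inner_vec_def vec_eq_iff sum_distrib_right
      sum_distrib_left mult_ac)

lemma inner_outer: "inner (outer u v) M = inner u (M *v v)"
  by (simp add: outer_def inner_vec_def matrix_vector_mult_def sum_distrib_left mult_ac)

text \<open>The Householder reflection in the hyperplane orthogonal to \<open>v\<close>; such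
  matrices and their products serve as the test rotations below.\<close>

definition reflection :: "real^'n \<Rightarrow> real^'n^'n" where
  "reflection v = mat 1 - (2 / inner v v) *\<^sub>R outer v v"

lemma orthogonal_reflection:
  assumes "v \<noteq> 0"
  shows "orthogonal_matrix (reflection v)"
proof -
  define c where "c = 2 / inner v v"
  have c: "c * inner v v = 2"
    using assms by (simp add: c_def)
  have "transpose (reflection v) ** reflection v
      = (mat 1 - c *\<^sub>R outer v v) ** (mat 1 - c *\<^sub>R outer v v)"
    by (simp add: reflection_def c_def transpose_diff transpose_scalar transpose_outer)
  also have "\<dots> = mat 1 + (c * (c * inner v v) - 2 * c) *\<^sub>R outer v v"
    by (simp add: matrix_mult_linear_simps outer_mult_outer) (simp add: vec_eq_iff algebra_simps)
  finally show ?thesis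
    unfolding c by (simp add: orthogonal_matrix)
qed

text \<open>A single reflection gives semidefiniteness.  The product of the reflections along
  \<open>axis i 1\<close> and \<open>axis i 1 + t axis j 1\<close> rotates the coordinate plane by an angle of order \<open>t\<close>,
  and letting \<open>t\<close> tend to zero gives symmetry.\<close>

lemma trace_maximal_imp_symmetric_psd:
  fixes M :: "real^'n^'n"
  assumes max: "\<And>R. orthogonal_matrix R \<Longrightarrow> inner R M \<le> inner (mat 1) M"
  shows "transpose M = M" "0 \<le> inner x (M *v x)"
proof -
  show psd: "0 \<le> inner x (M *v x)" for x
  proof (cases "x = 0")
    case False
    then have "0 \<le> 2 / inner x x * inner x (M *v x)"
      using max[OF orthogonal_reflection[OF False]]
      by (simp add: reflection_def inner_diff_left inner_outer)
    moreover have "0 < 2 / inner x x"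
      using False by simp
    ultimately show ?thesis
      unfolding zero_le_mult_iff by linarith
  qed simp
  have "M $ i $ j = M $ j $ i" if ij: "i \<noteq> j" for i j
  proof -
    let ?u = "axis i 1 :: real^'n" and ?w = "axis j 1 :: real^'n"
    \<comment> \<open>These are the coefficients of the quadratic in \<open>t\<close> that
      maximality keeps nonnegative; \<open>k\<close> is the asymmetry of \<open>M\<close> at the
      entry in question.\<close>
    define p k where "p = inner ?u (M *v ?u) + inner ?w (M *v ?w)"
      and "k = inner ?w (M *v ?u) - inner ?u (M *v ?w)"
    have orth: "inner ?u ?w = 0" "inner ?w ?u = 0" "inner ?u ?u = 1" "inner ?w ?w = 1"
      using ij by (auto simp: inner_axis_axis)
    have quad: "0 \<le> t\<^sup>2 * p + t * k" for t
    proof -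
      let ?v = "?u + t *\<^sub>R ?w"
      have vv: "inner ?v ?v = 1 + t\<^sup>2" and uv: "inner ?u ?v = 1"
        by (simp_all add: inner_add_left inner_add_right orth power2_eq_square)
      then have "?v \<noteq> 0"
        by (metis inner_zero_right zero_neq_one)
      moreover have "?u \<noteq> 0" by simp
      ultimately have "orthogonal_matrix (reflection ?u ** reflection ?v)"
        by (intro orthogonal_matrix_mul orthogonal_reflection)
      moreover have "reflection ?u ** reflection ?v = mat 1 - 2 *\<^sub>R outer ?u ?u
          - (2 / (1 + t\<^sup>2)) *\<^sub>R outer ?v ?v + (4 / (1 + t\<^sup>2)) *\<^sub>R outer ?u ?v"
        unfolding reflection_def vv orth
        by (simp only: matrix_mult_linear_simps outer_mult_outer uv matrix_mul_lid matrix_mul_rid)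
          (simp add: scaleR_right_diff_distrib)
      ultimately have "0 \<le> 2 * inner ?u (M *v ?u) + 2 / (1 + t\<^sup>2) * inner ?v (M *v ?v)
          - 4 / (1 + t\<^sup>2) * inner ?u (M *v ?v)"
        using max by (fastforce simp: inner_diff_left inner_add_left inner_outer)
      also have "\<dots> = 2 / (1 + t\<^sup>2) * ((1 + t\<^sup>2) * inner ?u (M *v ?u) + inner ?v (M *v ?v) - 2 * inner ?u (M *v ?v))"
      proof -
        have "2 * a + 2 / d * b - 4 / d * c = 2 / d * (d * a + b - 2 * c)" if "d > 0" for a b c d :: real
          using that by (simp add: field_simps)
        moreover have "0 < 1 + t\<^sup>2"
          by (simp add: add_pos_nonneg)
        ultimately show ?thesis by blast
      qed
      also have "(1 + t\<^sup>2) * inner ?u (M *v ?u) + inner ?v (M *v ?v) - 2 * inner ?u (M *v ?v) = t\<^sup>2 * p + t * k"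
        by (simp add: p_def k_def matrix_vector_right_distrib matrix_vector_mult_scaleR inner_add_left
            inner_add_right power2_eq_square algebra_simps)
      finally show ?thesis
        using zero_le_power2[of t] unfolding zero_le_mult_iff[of "2 / (1 + t\<^sup>2)"] zero_le_divide_iff divide_le_0_iff
        by linarith
    qed
    have p: "p \<ge> 0"
      unfolding p_def using psd by (intro add_nonneg_nonneg)
    \<comment> \<open>At this \<open>t\<close> the quadratic equals
      \<open>- (k / (1 + p))\<^sup>2\<close>, which forces \<open>k = 0\<close>;
      \<open>1 + p\<close> is positive even if \<open>p = 0\<close>.\<close>
    have "0 \<le> (- k / (1 + p))\<^sup>2 * p + (- k / (1 + p)) * k"
      by (rule quad)
    also have "\<dots> = - (k / (1 + p))\<^sup>2"
      using p by (simp add: power2_eq_square divide_simps) algebra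
    finally have "k = 0"
      using p by auto
    then show ?thesis
      by (simp add: k_def matrix_vector_mult_basis inner_axis' column_def)
  qed
  then show "transpose M = M"
    by (metis (no_types, lifting) transpose_def vec_eq_iff vec_lambda_beta)
qed

text \<open>The orthogonal Procrustes problem: rotations preserve the norm of
  \<open>Y2 ** Q\<close>, so a minimal distance means that the identity maximises the pairing with
  \<open>transpose (Y2 ** Q) ** Y1\<close>, and \<open>trace_maximal_imp_symmetric_psd\<close>
  applies.\<close>

lemma optimal_alignment:
  fixes Y1 Y2 :: "real^'r^'p"
  shows "\<exists>Q. orthogonal_matrix Q \<and> norm (Y2 ** Q - Y1) = quotient_dist Y1 Y2 \<and>
    transpose (transpose Y1 ** (Y2 ** Q)) = transpose Y1 ** (Y2 ** Q) \<and>
    (\<forall>x. 0 \<le> inner x ((transpose Y1 ** (Y2 ** Q)) *v x))"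
proof -
  obtain Q where Q: "orthogonal_matrix Q" "quotient_dist Y1 Y2 = norm (Y2 ** Q - Y1)"
    "\<And>R. orthogonal_matrix R \<Longrightarrow> norm (Y2 ** Q - Y1) \<le> norm (Y2 ** R - Y1)"
    using quotient_dist_minimizer[of Y1 Y2] by blast
  let ?Z = "Y2 ** Q"
  let ?M = "transpose ?Z ** Y1"
  have "inner R ?M \<le> inner (mat 1) ?M" if R: "orthogonal_matrix R" for R
  proof -
    have exp: "(norm (A - Y1))\<^sup>2 = (norm A)\<^sup>2 - 2 * inner A Y1 + (norm Y1)\<^sup>2" for A
      by (simp add: power2_norm_eq_inner inner_diff_left inner_diff_right inner_commute)
    have "norm (?Z - Y1) \<le> norm (?Z ** R - Y1)"
      using Q(3)[of "Q ** R"] orthogonal_matrix_mul[OF Q(1) R] by (simp add: matrix_mul_assoc)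
    then have "(norm (?Z - Y1))\<^sup>2 \<le> (norm (?Z ** R - Y1))\<^sup>2"
      by (intro power_mono) auto
    then have "inner (?Z ** R) Y1 \<le> inner (?Z ** mat 1) Y1"
      unfolding exp norm_matrix_mult_orthogonal[OF R] by simp
    then show ?thesis
      unfolding inner_matrix_mult_right[of ?Z] .
  qed
  note M = trace_maximal_imp_symmetric_psd[of ?M, OF this]
  have T: "transpose Y1 ** ?Z = transpose ?M"
    by (simp add: matrix_transpose_mul)
  show ?thesis
    by (intro exI[of _ Q] conjI Q(1) Q(2)[symmetric] allI) (simp_all only: T M transpose_transpose)
qed

text \<open>Here \<open>\<gamma>\<close> is the least eigenvalue of the symmetric part of \<open>Q\<close>, with eigenvector \<open>v\<close>,
  and \<open>u\<close> is the image of \<open>v\<close> under the skew part.  If \<open>\<gamma>\<close> were negative, the two signs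
  of the quadratic form of \<open>M\<close> at \<open>v\<close> and \<open>u\<close> would be incompatible.\<close>

lemma polar_factor_accretive:
  fixes M Q :: "real^'n^'n"
  assumes Q: "orthogonal_matrix Q" and M: "\<And>x. x \<noteq> 0 \<Longrightarrow> 0 < inner x (M *v x)"
    and sym: "transpose (M ** Q) = M ** Q" and psd: "\<And>x. 0 \<le> inner x ((M ** Q) *v x)"
  shows "0 \<le> inner x (Q *v x)"
proof -
  let ?N = "M ** Q" and ?J = "transpose Q"
  have QJ: "Q *v (?J *v y) = y" and JQ: "?J *v (Q *v y) = y" for y
    using Q by (simp_all add: matrix_vector_mul_assoc orthogonal_matrix_def)
  have inner_J: "inner y (?J *v z) = inner (Q *v y) z" for y z
    by (simp add: inner_matrix_vector_left)
  \<comment> \<open>The sign is reversed so that the lemma on largest eigenvalues delivers the least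
    eigenvalue of the symmetric part.\<close>
  define f where "f y = - (1/2) *\<^sub>R (Q *v y + ?J *v y)" for y
  have "linear f"
    unfolding f_def by (intro linear_compose_scale_right linear_compose_add) auto
  moreover have "inner (f y) z = inner y (f z)" for y z
    by (simp add: f_def inner_add_left inner_add_right inner_matrix_vector_left add.commute)
  moreover have "axis undefined 1 \<in> (UNIV :: (real^'n) set)" "axis undefined 1 \<noteq> (0 :: real^'n)"
    by simp_all
  then have "(UNIV :: (real^'n) set) \<noteq> {0}"
    by blast
  ultimately obtain v \<gamma>' where v: "norm v = 1" "f v = \<gamma>' *\<^sub>R v" "\<And>y. inner y (f y) \<le> \<gamma>' * (norm y)\<^sup>2"
    using self_adjoint_max_eigenvector[OF _ _ subspace_UNIV subset_UNIV] by (metis UNIV_I)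
  define \<gamma> where "\<gamma> = - \<gamma>'"
  have inner_f: "inner y (f y) = - inner y (Q *v y)" for y
    by (simp add: f_def inner_add_right inner_J inner_commute)
  have low: "\<gamma> * (norm y)\<^sup>2 \<le> inner y (Q *v y)" for y
    using v(3)[of y] by (simp add: inner_f \<gamma>_def)
  define u where "u = Q *v v - \<gamma> *\<^sub>R v"
  have vv: "inner v v = 1"
    using v(1) by (simp add: norm_eq_1)
  have Qv: "Q *v v = \<gamma> *\<^sub>R v + u"
    by (simp add: u_def)
  have "Q *v v + ?J *v v = (- 2) *\<^sub>R f v"
    by (simp add: f_def)
  then have "Q *v v + ?J *v v = (2 * \<gamma>) *\<^sub>R v"
    by (simp add: v(2) \<gamma>_def)
  moreover have "(2 * \<gamma>) *\<^sub>R v = \<gamma> *\<^sub>R v + \<gamma> *\<^sub>R v"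
    by (simp only: mult_2 scaleR_left_distrib)
  ultimately have Jv: "?J *v v = \<gamma> *\<^sub>R v - u"
    unfolding Qv by (simp only: add.assoc add_left_cancel) (simp add: eq_diff_eq add.commute)
  have "?J *v u = v - \<gamma> *\<^sub>R (?J *v v)"
    by (simp add: u_def matrix_vector_mult_diff_distrib matrix_vector_mult_scaleR JQ)
  then have Ju: "?J *v u = (1 - \<gamma>\<^sup>2) *\<^sub>R v + \<gamma> *\<^sub>R u"
    by (simp add: Jv algebra_simps power2_eq_square)
  have "inner v (Q *v v) = \<gamma>"
    using v(2) by (metis inner_f \<gamma>_def inner_scaleR_right vv mult.right_neutral minus_minus)
  then have vu: "inner v u = 0"
    by (simp add: u_def inner_diff_right vv)
  have "norm (Q *v v) = 1"
    by (simp add: norm_orthogonal_matrix_vector[OF Q] v(1))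
  then have uu: "inner u u = 1 - \<gamma>\<^sup>2"
    using vu by (simp add: norm_eq_1 Qv inner_add_left inner_add_right vv inner_commute power2_eq_square)
  \<comment> \<open>Writing \<open>M\<close> as \<open>M ** Q\<close> times
    \<open>transpose Q\<close> expresses its form at \<open>v\<close> and \<open>u\<close> through
    the symmetric matrix, because \<open>transpose Q\<close> maps the span of \<open>v\<close> and
    \<open>u\<close> to itself.\<close>
  have M_eq: "M *v y = ?N *v (?J *v y)" for y
    by (simp add: matrix_vector_mul_assoc[symmetric] QJ)
  define a b n where "a = inner v (?N *v v)" and "b = inner u (?N *v u)" and "n = inner v (?N *v u)"
  have n': "inner u (?N *v v) = n"
    unfolding n_def by (metis inner_commute inner_matrix_vector_left sym)
  have ab: "0 \<le> a" "0 \<le> b"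
    by (simp_all only: a_def b_def psd)
  have "v \<noteq> 0"
    using v(1) by auto
  then have "0 < inner v (M *v v)"
    by (rule M)
  then have i: "0 < \<gamma> * a - n"
    unfolding M_eq Jv
    by (simp add: matrix_vector_mult_diff_distrib matrix_vector_mult_scaleR inner_diff_right a_def n_def)
  have "0 \<le> inner u (M *v u)"
    using M[of u] by (cases "u = 0") auto
  then have ii: "0 \<le> (1 - \<gamma>\<^sup>2) * n + \<gamma> * b"
    unfolding M_eq Ju
    by (simp add: matrix_vector_right_distrib matrix_vector_mult_scaleR inner_add_right b_def n')
  \<comment> \<open>If \<gamma> were negative, \<open>i\<close> would give \<open>n < 0\<close> and
    \<open>ii\<close> would give \<open>(1 - \<gamma>\<^sup>2) * n \<ge> 0\<close>. As
    \<open>1 - \<gamma>\<^sup>2\<close> is the squared norm of \<open>u\<close>, this makes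
    \<open>u = 0\<close>, hence \<open>n = 0\<close>.\<close>
  have "0 \<le> \<gamma>"
  proof (rule ccontr)
    assume "\<not> 0 \<le> \<gamma>"
    then have neg: "\<gamma> * a \<le> 0" "\<gamma> * b \<le> 0"
      using ab by (auto simp: mult_le_0_iff)
    have "n < 0"
      using i neg by linarith
    moreover have "0 \<le> (1 - \<gamma>\<^sup>2) * n"
      using ii neg by linarith
    moreover have "0 \<le> 1 - \<gamma>\<^sup>2"
      using uu inner_ge_zero[of u] by linarith
    ultimately have "1 - \<gamma>\<^sup>2 = 0"
      by (smt (verit) mult_pos_neg)
    then have "u = 0"
      using uu by simp
    then show False
      using \<open>n < 0\<close> by (simp add: n_def)
  qed
  then show ?thesis
    using low[of x] by (smt (verit) mult_nonneg_nonneg zero_le_power2)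
qed

subsection \<open>Geodesic convexity of the region\<close>

lemma inner_symmetric_skew:
  fixes A K :: "real^'n^'n"
  assumes "transpose A = A" "transpose K = - K"
  shows "inner A K = 0"
  using inner_transpose[of A K] by (simp add: assms)

text \<open>For \<open>Z = X ** (Q - mat 1)\<close>, twice the product of \<open>X\<close> with the
  skew part is \<open>Z + Z ** transpose Q\<close>, whose summands have equal norm and, row by row,
  a nonnegative inner product. Accretivity excludes cases like \<open>Q = - mat 1\<close>, where the
  skew part vanishes.\<close>

lemma norm_skew_part_ge:
  fixes X :: "real^'n^'m" and Q :: "real^'n^'n"
  assumes Q: "orthogonal_matrix Q" and acc: "\<And>x. 0 \<le> inner x (Q *v x)"
  shows "(norm (X ** (Q - mat 1)))\<^sup>2 \<le> 2 * (norm (X ** ((1/2) *\<^sub>R (Q - transpose Q))))\<^sup>2"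
proof -
  let ?J = "transpose Q" and ?Z = "X ** (Q - mat 1)"
  have QJ: "Q ** ?J = mat 1"
    using Q by (simp add: orthogonal_matrix_def)
  have "(Q - mat 1) + (Q - mat 1) ** ?J = Q - ?J"
    by (simp add: matrix_mult_linear_simps QJ)
  then have "X ** ((1/2) *\<^sub>R (Q - ?J)) = (1/2) *\<^sub>R (X ** ((Q - mat 1) + (Q - mat 1) ** ?J))"
    by (simp only: matrix_mult_linear_simps)
  also have "\<dots> = (1/2) *\<^sub>R (?Z + ?Z ** ?J)"
    by (simp only: matrix_mult_linear_simps matrix_mul_assoc)
  finally have "norm (X ** ((1/2) *\<^sub>R (Q - ?J))) = 1/2 * norm (?Z + ?Z ** ?J)"
    by simp
  then have "4 * (norm (X ** ((1/2) *\<^sub>R (Q - ?J))))\<^sup>2 = (norm (?Z + ?Z ** ?J))\<^sup>2"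
    by (simp only: power_mult_distrib) (simp add: power2_eq_square)
  also have "\<dots> = (norm ?Z)\<^sup>2 + 2 * inner ?Z (?Z ** ?J) + (norm (?Z ** ?J))\<^sup>2"
    by (simp add: power2_norm_eq_inner inner_add_left inner_add_right inner_commute)
  also have "norm (?Z ** ?J) = norm ?Z"
    using Q by (simp add: norm_matrix_mult_orthogonal)
  finally have eq: "4 * (norm (X ** ((1/2) *\<^sub>R (Q - ?J))))\<^sup>2 = 2 * (norm ?Z)\<^sup>2 + 2 * inner ?Z (?Z ** ?J)"
    by simp
  have row: "(?Z ** ?J) $ i = Q *v (?Z $ i)" for i
    by (simp add: vec_eq_iff matrix_matrix_mult_def matrix_vector_mult_def transpose_def mult.commute)
  have "0 \<le> (\<Sum>i\<in>UNIV. inner (?Z $ i) (Q *v (?Z $ i)))"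
    by (intro sum_nonneg acc)
  then have "0 \<le> inner ?Z (?Z ** ?J)"
    by (simp only: inner_vec_def[of ?Z] row)
  with eq show ?thesis
    by linarith
qed

text \<open>The symmetric part of \<open>Q\<close> contributes nothing: the two diagonal pairings
  both equal the trace of \<open>B\<close>, and the mixed ones agree because \<open>B\<close> is
  symmetric.\<close>

lemma inner_mult_orthogonal_skew_part:
  fixes B Q :: "real^'n^'n"
  assumes Q: "orthogonal_matrix Q" and B: "transpose B = B"
  shows "inner (B ** Q) (Q - transpose Q) = inner (B ** ((1/2) *\<^sub>R (Q - transpose Q))) (Q - transpose Q)"
proof -
  let ?J = "transpose Q"
  have "inner (B ** Q) Q = inner B (mat 1)" "inner (B ** ?J) ?J = inner B (mat 1)"
    using Q by (simp_all add: inner_matrix_mult_left orthogonal_matrix_def)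
  moreover have "inner (B ** Q) ?J = inner (B ** ?J) Q"
    using inner_transpose[of B "?J ** ?J"] by (simp add: inner_matrix_mult_left matrix_transpose_mul B)
  ultimately show ?thesis
    by (simp add: matrix_mult_linear_simps inner_diff_left inner_diff_right field_simps)
qed

text \<open>Both perturbations of \<open>a = S *v x\<close> have norm at most a quarter of that of
  \<open>a\<close>, so at least \<open>1 - 1/4 - 1/4 - 1/16\<close> of its squared norm survives.
  This supplies the positivity required by \<open>polar_factor_accretive\<close>.\<close>

lemma inner_perturbed_pos:
  fixes S Y1 Y2 :: "real^'r^'p"
  assumes s: "0 < s" and lower: "\<And>x. s * norm x \<le> norm (S *v x)" and small: "4 * \<delta> \<le> s"
    and Y: "norm (Y1 - S) \<le> \<delta>" "norm (Y2 - S) \<le> \<delta>" and x: "x \<noteq> 0"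
  shows "0 < inner x ((transpose Y1 ** Y2) *v x)"
proof -
  define a e1 e2 where "a = S *v x" and "e1 = (Y1 - S) *v x" and "e2 = (Y2 - S) *v x"
  have "4 * (\<delta> * norm x) \<le> s * norm x"
    using mult_right_mono[OF small norm_ge_zero[of x]] by simp
  then have \<delta>: "4 * (\<delta> * norm x) \<le> norm a"
    using lower[of x] by (simp add: a_def)
  have "norm e1 \<le> \<delta> * norm x" "norm e2 \<le> \<delta> * norm x"
    unfolding e1_def e2_def
    using norm_matrix_vector_le_Frobenius Y by (meson mult_right_mono norm_ge_zero order_trans)+
  then have e: "norm e1 \<le> norm a / 4" "norm e2 \<le> norm a / 4"
    using \<delta> by auto
  have "0 < s * norm x"
    using s x by simp
  then have a: "0 < norm a"
    using lower[of x] unfolding a_def by (rule less_le_trans)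
  have "\<bar>inner a e2\<bar> \<le> norm a * (norm a / 4)" "\<bar>inner e1 a\<bar> \<le> (norm a / 4) * norm a"
    "\<bar>inner e1 e2\<bar> \<le> (norm a / 4) * (norm a / 4)"
    using e by (meson Cauchy_Schwarz_ineq2 mult_mono norm_ge_zero order_trans order_refl)+
  moreover have "inner x ((transpose Y1 ** Y2) *v x) = inner (Y1 *v x) (Y2 *v x)"
    by (simp add: inner_matrix_vector_left matrix_vector_mul_assoc)
  moreover have "Y1 *v x = a + e1" "Y2 *v x = a + e2"
    by (simp_all add: a_def e1_def e2_def matrix_vector_mult_diff_rdistrib)
  moreover have "inner a a = norm a * norm a"
    by (simp add: power2_norm_eq_inner[symmetric] power2_eq_square)
  moreover have "0 < norm a * norm a"
    using a by simp
  ultimately show ?thesis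
    by (simp add: inner_add_left inner_add_right abs_le_iff)
qed

text \<open>\<open>Q\<close> is the holonomy of the geodesic triangle with vertices \<open>S\<close>, \<open>Y1\<close>, \<open>Y2\<close>.  Testing
  \<open>B ** Q\<close>, where \<open>B = transpose S ** Y2\<close>, against the skew part \<open>K\<close> of \<open>Q\<close> bounds \<open>S ** K\<close>
  without reference to the largest singular value of \<open>S\<close>.\<close>

lemma holonomy_bound:
  fixes S Y1 Y2 :: "real^'r^'p"
  assumes s: "0 < s" and lower: "\<And>x. s * norm x \<le> norm (S *v x)" and \<delta>: "0 \<le> \<delta>" "4 * \<delta> \<le> s"
    and Y: "norm (Y1 - S) \<le> \<delta>" "norm (Y2 - S) \<le> \<delta>"
    and aligned: "transpose (transpose S ** Y1) = transpose S ** Y1"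
      "transpose (transpose S ** Y2) = transpose S ** Y2"
    and Q: "orthogonal_matrix Q"
    and sym: "transpose (transpose Y1 ** (Y2 ** Q)) = transpose Y1 ** (Y2 ** Q)"
    and psd: "\<And>x. 0 \<le> inner x ((transpose Y1 ** (Y2 ** Q)) *v x)"
  shows "norm (S ** (Q - mat 1)) \<le> 1/2 * norm (Y1 - Y2 ** Q)"
proof -
  define G K where "G = Y1 - Y2 ** Q" and "K = (1/2) *\<^sub>R (Q - transpose Q)"
  define B where "B = transpose S ** Y2"
  have skew: "transpose K = - K"
    by (simp add: K_def transpose_scalar transpose_diff flip: scaleR_minus_right)
  have K2: "Q - transpose Q = 2 *\<^sub>R K"
    by (simp add: K_def)
  have "inner (B ** Q) K = inner (B ** K) K"
    using inner_mult_orthogonal_skew_part[OF Q, of B] aligned(2) unfolding K_def[symmetric]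
    by (simp add: K2 B_def)
  moreover have "inner (B ** Q) K = - inner (transpose S ** G) K"
  proof -
    have "B ** Q = transpose S ** Y1 - transpose S ** G"
      by (simp add: B_def G_def matrix_mult_linear_simps matrix_mul_assoc)
    then show ?thesis
      by (simp add: inner_diff_left inner_symmetric_skew[OF aligned(1) skew])
  qed
  \<comment> \<open>Alignment of \<open>Y1\<close> with \<open>Y2 ** Q\<close> makes
    \<open>transpose Y1 ** G\<close> symmetric, hence orthogonal to \<open>K\<close>. Subtracting it
    replaces \<open>S\<close> by the small matrix \<open>Y1 - S\<close>.\<close>
  moreover have "inner (transpose S ** G) K = - inner (transpose (Y1 - S) ** G) K"
  proof -
    have "transpose (transpose Y1 ** G) = transpose Y1 ** G"
      by (simp add: G_def matrix_mult_linear_simps transpose_diff sym)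
        (simp add: matrix_transpose_mul)
    then have "inner (transpose Y1 ** G) K = 0"
      using skew by (rule inner_symmetric_skew)
    then show ?thesis
      by (simp add: transpose_diff matrix_mult_linear_simps inner_diff_left)
  qed
  ultimately have BK: "inner (B ** K) K = inner (transpose (Y1 - S) ** G) K"
    by simp
  also have "\<dots> = inner G ((Y1 - S) ** K)"
    by (simp add: inner_matrix_mult_right)
  also have "\<dots> \<le> norm G * (\<delta> * norm K)"
  proof -
    have "norm ((Y1 - S) ** K) \<le> \<delta> * norm K"
      using norm_matrix_mult_le_Frobenius Y(1) by (meson mult_right_mono norm_ge_zero order_trans)
    then show ?thesis
      using norm_cauchy_schwarz by (meson mult_left_mono norm_ge_zero order_trans)
  qed
  finally have upper: "inner (B ** K) K \<le> norm G * (\<delta> * norm K)" .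
  have "s * norm K \<le> norm (S ** K)"
    using lower s by (intro norm_matrix_mult_ge) auto
  then have \<delta>K: "4 * (\<delta> * norm K) \<le> norm (S ** K)"
    using mult_right_mono[OF \<delta>(2) norm_ge_zero[of K]] by simp
  have "inner (B ** K) K = inner (Y2 ** K) (S ** K)"
    by (simp add: B_def matrix_mul_assoc[symmetric] inner_matrix_mult_right)
  also have "\<dots> = (norm (S ** K))\<^sup>2 + inner ((Y2 - S) ** K) (S ** K)"
    by (simp add: matrix_mult_linear_simps inner_diff_left power2_norm_eq_inner)
  finally have eq: "inner (B ** K) K = (norm (S ** K))\<^sup>2 + inner ((Y2 - S) ** K) (S ** K)" .
  have "norm ((Y2 - S) ** K) \<le> \<delta> * norm K"
    using norm_matrix_mult_le_Frobenius Y(2) by (meson mult_right_mono norm_ge_zero order_trans)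
  then have "norm ((Y2 - S) ** K) \<le> norm (S ** K) / 4"
    using \<delta>K by simp
  then have "\<bar>inner ((Y2 - S) ** K) (S ** K)\<bar> \<le> norm (S ** K) / 4 * norm (S ** K)"
    by (meson Cauchy_Schwarz_ineq2 mult_right_mono norm_ge_zero order_trans)
  moreover have "norm G * (\<delta> * norm K) \<le> norm G * (norm (S ** K) / 4)"
    using \<delta>K by (intro mult_left_mono) auto
  \<comment> \<open>The lower bound keeps three quarters of the squared norm of
    \<open>S ** K\<close>; the upper bound is a quarter of the product of the norms of
    \<open>G\<close> and \<open>S ** K\<close>.\<close>
  ultimately have "3 * norm (S ** K) * norm (S ** K) \<le> norm G * norm (S ** K)"
    using upper eq by (simp add: power2_eq_square abs_le_iff)
  then have "3 * norm (S ** K) \<le> norm G"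
    by (cases "norm (S ** K) = 0") (simp_all add: mult_le_cancel_right)
  then have "(3 * norm (S ** K))\<^sup>2 \<le> (norm G)\<^sup>2"
    by (intro power_mono) auto
  moreover have "0 \<le> inner x (Q *v x)" for x
    using Q inner_perturbed_pos[OF s lower \<delta>(2) Y] sym psd
    by (intro polar_factor_accretive[of Q "transpose Y1 ** Y2"]) (simp_all add: matrix_mul_assoc)
  then have "(norm (S ** (Q - mat 1)))\<^sup>2 \<le> 2 * (norm (S ** K))\<^sup>2"
    unfolding K_def by (intro norm_skew_part_ge Q)
  \<comment> \<open>The factor obtained is \<open>2/9\<close>, which is below
    \<open>1/4\<close>.\<close>
  ultimately have "(norm (S ** (Q - mat 1)))\<^sup>2 \<le> (1/2 * norm G)\<^sup>2"
    using zero_le_power2[of "norm G"]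
    by (simp only: power_mult_distrib power2_eq_square[of "1/2"] power2_eq_square[of "3 :: real"])
  then show ?thesis
    unfolding G_def by (rule power2_le_imp_le) simp
qed

text \<open>The rotations \<open>mat 1\<close> and \<open>Q\<close>, optimal at the two end points, suffice at every time:
  the squared distances to \<open>S\<close> and \<open>S ** Q\<close>, averaged with weights \<open>1 - t\<close> and \<open>t\<close>, give at
  most \<open>\<delta>\<^sup>2\<close>.\<close>

lemma aligned_segment_in_ball:
  fixes S Y1 Y2 :: "real^'r^'p"
  assumes Y: "norm (Y1 - S) \<le> \<delta>" "norm (Y2 - S) \<le> \<delta>" and \<delta>: "0 \<le> \<delta>"
    and Q: "orthogonal_matrix Q" and t: "0 \<le> t" "t \<le> 1"
    and hol: "norm (S ** (Q - mat 1)) \<le> 1/2 * norm (Y1 - Y2 ** Q)"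
  shows "\<exists>R. orthogonal_matrix R \<and> norm (S ** R - (Y1 + t *\<^sub>R (Y2 ** Q - Y1))) \<le> \<delta>"
proof -
  define G E F X where "G = Y1 - Y2 ** Q" and "E = Y1 - S" and "F = (Y2 - S) ** Q"
    and "X = S ** (Q - mat 1)"
  let ?c = "Y1 + t *\<^sub>R (Y2 ** Q - Y1)"
  have F_norm: "norm F = norm (Y2 - S)"
    unfolding F_def by (rule norm_matrix_mult_orthogonal[OF Q])
  have c1: "?c - S = E - t *\<^sub>R G"
    by (simp add: E_def G_def scaleR_right_diff_distrib)
  have c2: "?c - S ** Q = F + (1 - t) *\<^sub>R G"
    by (simp add: F_def G_def matrix_mult_linear_simps algebra_simps)
  have FE: "F - E = - G - X"
    by (simp add: F_def E_def G_def X_def matrix_mult_linear_simps)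
  have "- inner X G \<le> norm X * norm G"
    using norm_cauchy_schwarz[of "- X" G] by simp
  also have "\<dots> \<le> 1/2 * norm G * norm G"
    using hol unfolding X_def G_def by (intro mult_right_mono) auto
  finally have X: "- 2 * inner X G \<le> (norm G)\<^sup>2"
    by (simp add: power2_eq_square)
  have "inner (F - E) G = - (norm G)\<^sup>2 - inner X G"
    unfolding FE by (simp add: inner_diff_left power2_norm_eq_inner)
  \<comment> \<open>Since \<open>F - E = - G - X\<close>, the left side is
    \<open>- (norm G)\<^sup>2 - 2 * inner X G\<close>; the constant \<open>1/2\<close> in the
    holonomy bound is exactly what makes it nonpositive. It is the coefficient of
    \<open>t * (1 - t)\<close> in the averaged squared distance.\<close>
  then have neg: "(norm G)\<^sup>2 + 2 * inner (F - E) G \<le> 0"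
    using X by simp
  have "(1 - t) * (norm (?c - S))\<^sup>2 + t * (norm (?c - S ** Q))\<^sup>2
      = (1 - t) * (norm E)\<^sup>2 + t * (norm F)\<^sup>2 + t * (1 - t) * ((norm G)\<^sup>2 + 2 * inner (F - E) G)"
    unfolding c1 c2 power2_norm_eq_inner
    by (simp add: inner_diff_left inner_diff_right inner_add_left inner_add_right inner_commute)
      (simp add: algebra_simps)
  also have "\<dots> \<le> (1 - t) * \<delta>\<^sup>2 + t * \<delta>\<^sup>2 + 0"
  proof (intro add_mono mult_left_mono)
    show "(norm E)\<^sup>2 \<le> \<delta>\<^sup>2" "(norm F)\<^sup>2 \<le> \<delta>\<^sup>2"
      using Y by (auto simp: E_def F_norm intro!: power_mono)
    show "t * (1 - t) * ((norm G)\<^sup>2 + 2 * inner (F - E) G) \<le> 0"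
      using t neg by (intro mult_nonneg_nonpos) auto
  qed (use t in auto)
  finally have avg: "(1 - t) * (norm (?c - S))\<^sup>2 + t * (norm (?c - S ** Q))\<^sup>2 \<le> \<delta>\<^sup>2"
    by (simp add: algebra_simps)
  have "(norm (?c - S))\<^sup>2 \<le> \<delta>\<^sup>2 \<or> (norm (?c - S ** Q))\<^sup>2 \<le> \<delta>\<^sup>2"
  proof (rule ccontr)
    assume "\<not> ?thesis"
    then have lt: "\<delta>\<^sup>2 < (norm (?c - S))\<^sup>2" "\<delta>\<^sup>2 < (norm (?c - S ** Q))\<^sup>2"
      by auto
    have "\<delta>\<^sup>2 = (1 - t) * \<delta>\<^sup>2 + t * \<delta>\<^sup>2"
      by (simp add: algebra_simps)
    also have "\<dots> < (1 - t) * (norm (?c - S))\<^sup>2 + t * (norm (?c - S ** Q))\<^sup>2"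
    proof (cases "t = 0")
      case False
      with t lt show ?thesis
        by (intro add_le_less_mono mult_left_mono mult_strict_left_mono) auto
    qed (use lt in simp)
    finally show False
      using avg by simp
  qed
  then have "norm (S ** mat 1 - ?c) \<le> \<delta> \<or> norm (S ** Q - ?c) \<le> \<delta>"
    using \<delta> by (auto simp: norm_minus_commute intro: power2_le_imp_le)
  then show ?thesis
    using Q orthogonal_matrix_id by blast
qed

section \<open>Segments as geodesics in the region\<close>

text \<open>On a nonzero kernel vector of \<open>Y\<close> the difference \<open>S ** R - Y\<close>
  would stretch by at least \<open>s\<close>, more than its norm allows. This keeps segments inside
  the manifold.\<close>

lemma full_column_rank_near:
  fixes S Y :: "real^'r^'p"
  assumes lower: "\<And>x. s * norm x \<le> norm (S *v x)" and \<delta>: "\<delta> < s"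
    and R: "orthogonal_matrix R" and Y: "norm (S ** R - Y) \<le> \<delta>"
  shows "full_column_rank Y"
proof -
  have "x = 0" if "Y *v x = 0" for x
  proof (rule ccontr)
    assume "x \<noteq> 0"
    then have "\<delta> * norm x < s * norm x"
      using \<delta> by simp
    also have "\<dots> = s * norm (R *v x)"
      by (simp add: norm_orthogonal_matrix_vector[OF R])
    also have "\<dots> \<le> norm ((S ** R - Y) *v x)"
      using lower[of "R *v x"] that by (simp add: matrix_vector_mult_diff_rdistrib matrix_vector_mul_assoc)
    also have "\<dots> \<le> \<delta> * norm x"
      using norm_matrix_vector_le_Frobenius[of "S ** R - Y" x] Y
      by (meson mult_right_mono norm_ge_zero order_trans)
    finally show False by simp
  qed
  then show ?thesis
    using matrix_nonfull_linear_equations_eq[of Y] unfolding full_column_rank_def by blast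
qed

text \<open>The segment is its own horizontal lift: alignment at the start makes the constant
  velocity horizontal at every time, and the acceleration is zero.\<close>

lemma aligned_segment_geodesic:
  fixes Y1 Y2 :: "real^'r^'p"
  assumes sym: "transpose (transpose Y1 ** Y2) = transpose Y1 ** Y2"
    and full: "\<And>t. t \<in> {0..1} \<Longrightarrow> full_column_rank (Y1 + t *\<^sub>R (Y2 - Y1))"
  shows "geodesic (\<lambda>t. orbit (Y1 + t *\<^sub>R (Y2 - Y1)))"
  unfolding geodesic_def
proof (intro exI ballI conjI)
  fix t :: real
  assume "t \<in> {0..1}"
  then show "full_column_rank (Y1 + t *\<^sub>R (Y2 - Y1))"
    by (rule full)
  show "((\<lambda>t. Y1 + t *\<^sub>R (Y2 - Y1)) has_vector_derivative (Y2 - Y1)) (at t within {0..1})"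
    by (auto intro!: derivative_eq_intros)
  show "((\<lambda>t. Y2 - Y1) has_vector_derivative 0) (at t within {0..1})"
    by simp
  show "Y2 - Y1 \<in> horizontal (Y1 + t *\<^sub>R (Y2 - Y1))"
    unfolding horizontal_def
    by (simp add: transpose_add transpose_scalar matrix_mult_linear_simps transpose_diff
        sym[unfolded matrix_transpose_mul transpose_transpose] matrix_transpose_mul)
  show "hor_proj (Y1 + t *\<^sub>R (Y2 - Y1)) 0 = 0"
    unfolding hor_proj_def by (intro closest_point_self subspace_0 subspace_horizontal)
qed simp

lemma orbit_ball_geodesically_convex:
  fixes S :: "real^'r^'p"
  assumes s: "0 < s" and lower: "\<And>x. s * norm x \<le> norm (S *v x)" and \<delta>: "0 \<le> \<delta>" "4 * \<delta> \<le> s"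
  shows "geodesically_convex (orbit ` {Y. full_column_rank Y \<and> quotient_dist Y S \<le> \<delta>})"
    (is "geodesically_convex (orbit ` ?R)")
  unfolding geodesically_convex_def
proof (intro conjI ballI)
  show "orbit ` ?R \<subseteq> quotient_manifold"
    unfolding quotient_manifold_def by blast
  fix P1 P2
  assume P: "P1 \<in> orbit ` ?R" "P2 \<in> orbit ` ?R"
  \<comment> \<open>The rotation is moved from \<open>S\<close> to the point, so that both end
    points are aligned with the same fixed \<open>S\<close>.\<close>
  have aligned_repr: "\<exists>Y. P = orbit Y \<and> norm (Y - S) \<le> \<delta> \<and>
      transpose (transpose S ** Y) = transpose S ** Y" if P: "P \<in> orbit ` ?R" for P
  proof -
    obtain Z where Z: "P = orbit Z" "quotient_dist Z S \<le> \<delta>"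
      using P by blast
    obtain A where A: "orthogonal_matrix A" "norm (S ** A - Z) = quotient_dist Z S"
      "transpose (transpose Z ** (S ** A)) = transpose Z ** (S ** A)"
        using optimal_alignment[of S Z] by blast
    let ?J = "transpose A"
    have AJ: "A ** ?J = mat 1" "?J ** A = mat 1"
      using A(1) by (simp_all add: orthogonal_matrix_def)
    have "norm (Z ** ?J - S) = norm ((Z ** ?J - S) ** A)"
      using A(1) by (simp add: norm_matrix_mult_orthogonal)
    also have "(Z ** ?J - S) ** A = Z - S ** A"
      by (simp add: matrix_mult_linear_simps matrix_mul_assoc[symmetric] AJ)
    finally have "norm (Z ** ?J - S) \<le> \<delta>"
      using A(2) Z(2) by (simp add: norm_minus_commute)
    \<comment> \<open>The transpose is a conjugate by \<open>A\<close> of the symmetric matrix that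
      alignment provides.\<close>
    moreover have "transpose (transpose S ** (Z ** ?J)) = transpose S ** (Z ** ?J)"
    proof -
      have "transpose (transpose S ** (Z ** ?J)) = A ** (transpose Z ** (S ** A)) ** ?J"
        by (simp add: matrix_transpose_mul matrix_mul_assoc[symmetric] AJ)
      also have "\<dots> = A ** (?J ** transpose S ** Z) ** ?J"
        by (subst A(3)[symmetric]) (simp add: matrix_transpose_mul)
      also have "\<dots> = transpose S ** (Z ** ?J)"
        by (simp add: matrix_mul_assoc AJ)
      finally show ?thesis .
    qed
    moreover have "P = orbit (Z ** ?J)"
      using A(1) Z(1) by (simp add: orbit_mult_orthogonal)
    ultimately show ?thesis by blast
  qed
  obtain Y1 where Y1: "P1 = orbit Y1" "norm (Y1 - S) \<le> \<delta>" "transpose (transpose S ** Y1) = transpose S ** Y1"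
    using aligned_repr[OF P(1)] by blast
  obtain Y2 where Y2: "P2 = orbit Y2" "norm (Y2 - S) \<le> \<delta>" "transpose (transpose S ** Y2) = transpose S ** Y2"
    using aligned_repr[OF P(2)] by blast
  obtain Q where Q: "orthogonal_matrix Q"
    "transpose (transpose Y1 ** (Y2 ** Q)) = transpose Y1 ** (Y2 ** Q)"
    "\<And>x. 0 \<le> inner x ((transpose Y1 ** (Y2 ** Q)) *v x)"
    using optimal_alignment[of Y2 Y1] by blast
  let ?c = "\<lambda>t. Y1 + t *\<^sub>R (Y2 ** Q - Y1)"
  have in_region: "?c t \<in> ?R" if t: "t \<in> {0..1}" for t
  proof -
    have "norm (S ** (Q - mat 1)) \<le> 1/2 * norm (Y1 - Y2 ** Q)"
      by (rule holonomy_bound[OF s lower \<delta> Y1(2) Y2(2) Y1(3) Y2(3) Q])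
    then obtain R where R: "orthogonal_matrix R" "norm (S ** R - ?c t) \<le> \<delta>"
      using aligned_segment_in_ball[OF Y1(2) Y2(2) \<delta>(1) Q(1)] t by auto
    moreover have "\<delta> < s"
      using s \<delta> by linarith
    ultimately show ?thesis
      using full_column_rank_near[OF lower _ R] quotient_dist_le_iff by blast
  qed
  let ?\<gamma> = "\<lambda>t. orbit (?c t)"
  have "geodesic ?\<gamma>"
    using in_region Q(2) by (intro aligned_segment_geodesic) auto
  moreover have "?\<gamma> 0 = P1" "?\<gamma> 1 = P2"
    using Q(1) by (simp_all add: Y1(1) Y2(1) orbit_mult_orthogonal)
  ultimately show "\<exists>\<gamma>. geodesic \<gamma> \<and> \<gamma> 0 = P1 \<and> \<gamma> 1 = P2 \<and> (\<forall>t\<in>{0..1}. \<gamma> t \<in> orbit ` ?R)"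
    using in_region by (intro exI[of _ ?\<gamma>]) blast
qed

section \<open>Constants of the region and assembly of the bounds\<close>

theorem theorem9:
  fixes Ystar :: "real^'r^'p" and Xstar :: "real^'p^'p" and \<mu> :: real
  assumes "CARD('r) \<le> CARD('p)"
    and "full_column_rank Ystar"
    and "Xstar = Ystar ** transpose Ystar"
    and "0 \<le> \<mu>" and "\<mu> \<le> 1/3"
  shows "(\<forall>Y \<in> region Ystar \<mu>.
            hess_min (cost Xstar) Y
              \<ge> (2 * (1 - \<mu> / cond_number Ystar)\<^sup>2 - 14/3 * \<mu>) * (sing_val CARD('r) Ystar)\<^sup>2 \<and>
            hess_max (cost Xstar) Y
              \<le> 4 * (sing_val 1 Ystar + \<mu> * sing_val CARD('r) Ystar / cond_number Ystar)\<^sup>2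
                 + 14 * \<mu> * (sing_val CARD('r) Ystar)\<^sup>2 / 3) \<and>
         ((1 - \<mu> / cond_number Ystar)\<^sup>2 - 7 * \<mu> / 3 > 0 \<longrightarrow>
            geodesically_strongly_convex (cost Xstar) (orbit ` region Ystar \<mu>) \<and>
            geodesically_smooth (cost Xstar) (orbit ` region Ystar \<mu>)) \<and>
         (\<mu> < (13 - sqrt 133) / 6 \<longrightarrow> (1 - \<mu> / cond_number Ystar)\<^sup>2 - 7 * \<mu> / 3 > 0)"
proof -
  define s \<sigma> e where "s = sing_val CARD('r) Ystar" and "\<sigma> = sing_val 1 Ystar"
    and "e = \<mu> / cond_number Ystar"
  define \<delta> where "\<delta> = \<mu> * s / cond_number Ystar"
  define m L where "m = (2 * (1 - e)\<^sup>2 - 14/3 * \<mu>) * s\<^sup>2"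
    and "L = 4 * (\<sigma> + \<delta>)\<^sup>2 + 14 * \<mu> * s\<^sup>2 / 3"
  note \<mu> = assms(4,5)
  have s: "0 < s" and s\<sigma>: "s \<le> \<sigma>" and lower: "s * norm x \<le> norm (Ystar *v x)"
    and upper: "norm (Ystar *v x) \<le> \<sigma> * norm x" for x
    using singular_value_bounds[of Ystar] assms(2) by (simp_all add: s_def \<sigma>_def)
  have \<sigma>: "0 < \<sigma>" using s s\<sigma> by linarith
  have cond: "cond_number Ystar = \<sigma> / s"
    by (simp add: cond_number_def s_def \<sigma>_def)
  have e: "0 \<le> e" "e \<le> \<mu>"
    using \<mu> s \<sigma> s\<sigma> mult_left_mono[OF s\<sigma> \<mu>(1)] by (simp_all add: e_def cond divide_simps)
  have \<delta>e: "\<delta> = e * s"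
    by (simp add: \<delta>_def e_def)
  have \<delta>0: "0 \<le> \<delta>" and \<delta>s: "\<delta> \<le> s"
    using e \<mu> s mult_right_mono[of e 1 s] by (simp_all add: \<delta>e)
  \<comment> \<open>Dividing the radius by the condition number cancels \<sigma>, so the first-order
    perturbation is measured in \<open>s\<close> alone.\<close>
  have \<sigma>\<delta>: "\<sigma> * \<delta> = \<mu> * s\<^sup>2"
    using s \<sigma> by (simp add: \<delta>_def cond power2_eq_square)
  have "e * e \<le> \<mu> * (1/3)"
    using e \<mu> by (intro mult_mono) auto
  then have "\<delta>\<^sup>2 \<le> \<mu> * (1/3) * s\<^sup>2"
    unfolding \<delta>e power_mult_distrib power2_eq_square[of e] by (intro mult_right_mono) auto
  \<comment> \<open>The constant is \<open>2 * (2 + 1/3)\<close>: the \<open>1/3\<close> comes from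
    \<open>e \<le> \<mu>\<close> and \<open>\<mu> \<le> 1/3\<close> in the quadratic term.\<close>
  then have pert: "2 * (2 * \<sigma> * \<delta> + \<delta>\<^sup>2) \<le> 14/3 * \<mu> * s\<^sup>2"
    using \<sigma>\<delta> by simp
  have m: "m \<le> 2 * (s - \<delta>)\<^sup>2 - 2 * (2 * \<sigma> * \<delta> + \<delta>\<^sup>2)"
    using pert unfolding m_def \<delta>e by (simp add: power2_eq_square algebra_simps)
  have L: "4 * (\<sigma> + \<delta>)\<^sup>2 + 2 * (2 * \<sigma> * \<delta> + \<delta>\<^sup>2) \<le> L"
    using pert by (simp add: L_def)
  have sym: "transpose Xstar = Xstar"
    by (simp add: assms(3) matrix_transpose_mul)
  have region: "region Ystar \<mu> = {Y. full_column_rank Y \<and> quotient_dist Y Ystar \<le> \<delta>}"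
    by (simp add: region_def \<delta>_def s_def)
  have hess: "m * (norm \<theta>)\<^sup>2 \<le> lifted_hess (cost Xstar) Y \<theta>"
      "lifted_hess (cost Xstar) Y \<theta> \<le> L * (norm \<theta>)\<^sup>2"
    if Y: "Y \<in> region Ystar \<mu>" and \<theta>: "\<theta> \<in> horizontal Y" for Y \<theta>
  proof -
    obtain R where R: "orthogonal_matrix R" "norm (Ystar ** R - Y) \<le> \<delta>"
      using Y unfolding region quotient_dist_le_iff by blast
    have X: "(Ystar ** R) ** transpose (Ystar ** R) = Xstar"
    proof -
      have "(Ystar ** R) ** transpose (Ystar ** R) = Ystar ** (R ** transpose R) ** transpose Ystar"
        by (simp add: matrix_transpose_mul matrix_mul_assoc)
      then show ?thesis
        using R(1) by (simp add: orthogonal_matrix_def assms(3))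
    qed
    have "s * norm x \<le> norm ((Ystar ** R) *v x)" "norm ((Ystar ** R) *v x) \<le> \<sigma> * norm x" for x
      using lower[of "R *v x"] upper[of "R *v x"]
      by (simp_all add: norm_orthogonal_matrix_vector[OF R(1)] matrix_vector_mul_assoc)
    note bounds = lifted_hess_cost_bounds[OF this less_imp_le[OF \<sigma>] \<delta>0 \<delta>s _ \<theta>, unfolded X norm_minus_commute[of Y], OF R(2)]
    show "m * (norm \<theta>)\<^sup>2 \<le> lifted_hess (cost Xstar) Y \<theta>"
      by (rule order_trans[OF mult_right_mono[OF m] bounds(1)]) simp
    show "lifted_hess (cost Xstar) Y \<theta> \<le> L * (norm \<theta>)\<^sup>2"
      by (rule order_trans[OF bounds(2) mult_right_mono[OF L]]) simp
  qed
  have "m \<le> hess_min (cost Xstar) Y \<and> hess_max (cost Xstar) Y \<le> L" if Y: "Y \<in> region Ystar \<mu>" for Y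
  proof
    have full: "full_column_rank Y"
      using Y by (simp add: region)
    show "m \<le> hess_min (cost Xstar) Y"
      by (rule hess_min_attained[OF sym full]) (use hess(1)[OF Y] in fastforce)
    show "hess_max (cost Xstar) Y \<le> L"
      by (rule hess_max_attained[OF sym full]) (use hess(2)[OF Y] in fastforce)
  qed
  moreover have "geodesically_strongly_convex (cost Xstar) (orbit ` region Ystar \<mu>) \<and>
      geodesically_smooth (cost Xstar) (orbit ` region Ystar \<mu>)" if pos: "(1 - e)\<^sup>2 - 7 * \<mu> / 3 > 0"
  proof
    \<comment> \<open>If \<open>e\<close> exceeded \<open>1/4\<close>, then
      \<open>(1 - e)\<^sup>2\<close> would be at most \<open>9/16\<close>, below
      \<open>7/12\<close>, which is less than \<open>7 * \<mu> / 3\<close> because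
      \<open>e \<le> \<mu>\<close>.\<close>
    have "4 * e \<le> 1"
    proof (rule ccontr)
      assume "\<not> 4 * e \<le> 1"
      then have "(1 - e)\<^sup>2 \<le> (3/4)\<^sup>2"
        using e \<mu> by (intro power_mono) auto
      then show False
        using pos e \<open>\<not> 4 * e \<le> 1\<close> by (simp add: power2_eq_square)
    qed
    then have \<delta>4: "4 * \<delta> \<le> s"
      using mult_right_mono[of "4 * e" 1 s] s by (simp add: \<delta>e)
    have conv: "geodesically_convex (orbit ` region Ystar \<mu>)"
      unfolding region by (rule orbit_ball_geodesically_convex[OF s lower \<delta>0 \<delta>4])
    have "0 < m"
      unfolding m_def using pos s by (intro mult_pos_pos) auto
    then show "geodesically_strongly_convex (cost Xstar) (orbit ` region Ystar \<mu>)"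
      unfolding geodesically_strongly_convex_def
      by (intro conjI conv exI[of _ m] allI impI ballI twice_differentiable_at_cost[OF sym] hess(1))
        (auto intro: region_orbit_invariant)
    have "orbit ` region Ystar \<mu> \<subseteq> quotient_manifold"
      using conv by (simp add: geodesically_convex_def)
    then show "geodesically_smooth (cost Xstar) (orbit ` region Ystar \<mu>)"
      unfolding geodesically_smooth_def
      by (intro conjI exI[of _ L] allI impI ballI twice_differentiable_at_cost[OF sym] hess(2))
        (auto intro: region_orbit_invariant)
  qed
  moreover have "(1 - e)\<^sup>2 - 7 * \<mu> / 3 > 0" if "\<mu> < (13 - sqrt 133) / 6"
  proof -
    \<comment> \<open>The bound on \<mu> is the smaller root of
      \<open>(1 - \<mu>)\<^sup>2 - 7 * \<mu> / 3\<close>, and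
      \<open>(13 - 6 * \<mu>)\<^sup>2 - 133\<close> is 36 times this polynomial.\<close>
    have "(sqrt 133)\<^sup>2 < (13 - 6 * \<mu>)\<^sup>2"
      using that by (intro power_strict_mono) auto
    then have "0 < (1 - \<mu>)\<^sup>2 - 7 * \<mu> / 3"
      by (simp add: power2_eq_square algebra_simps)
    also have "(1 - \<mu>)\<^sup>2 \<le> (1 - e)\<^sup>2"
      using e \<mu> by (intro power_mono) auto
    finally show ?thesis by simp
  qed
  ultimately show ?thesis
    unfolding m_def L_def \<delta>_def e_def s_def \<sigma>_def by blast
qed

end
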